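(* Let $N\in\mathbb{N}$, let $(\mathcal{U},\|\cdot\|_{\mathcal{U}})$ be a Banach ideal of $N$-linear forms and let $\mathbf{X}=X_1\times\cdots\times X_N$ be an $N$-tuple of Banach spaces. If $\mathcal{U}$ is stable at $\mathbf{X}$, then the set of those $N$-linear forms in $\mathcal{U}(\mathbf{X})$ all of whose Arens extensions attain the supremum norm at the same $N$-tuple is $\|\cdot\|_{\mathcal{U}}$-dense in $\mathcal{U}(\mathbf{X})$.
   Context: Notation: $\mathbb{K}$ is the scalar field ($\mathbb{R}$ or $\mathbb{C}$), $X'$ is the topological dual of $X$, $B_X$ the closed unit ball. For Banach spaces $X_1,\dots,X_N$ write $\mathbf{X}=X_1\times\cdots\times X_N$; $\mathcal{L}(^N\mathbf{X})$ is the space of continuous $N$-linear forms $\Phi:\mathbf{X}\to\mathbb{K}$ with the supremum norm $\|\Phi\|$ over $B_{X_1}\times\cdots\times B_{X_N}$. Ideal of $N$-linear forms: a normed ideal of $N$-linear forms is a pair $(\mathcal{U},\|\cdot\|_{\mathcal{U}})$ such that for every $N$-tuple of Banach spaces $\mathbf{X}$: (i) $\mathcal{U}(\mathbf{X})=\mathcal{U}\cap\mathcal{L}(^N\mathbf{X})$ is a linear subspace of $\mathcal{L}(^N\mathbf{X})$ and $\|\cdot\|_{\mathcal{U}}$ is a norm on it; (ii) for every $N$-tuple of Banach spaces $\mathbf{Z}=Z_1\times\cdots\times Z_N$, all bounded linear operators $T_i:Z_i\to X_i$ and all $\Phi\in\mathcal{U}(\mathbf{X})$, the form $\Phi\circ(T_1,\dots,T_N)$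 belongs to $\mathcal{U}(\mathbf{Z})$ with $\|\Phi\circ(T_1,\dots,T_N)\|_{\mathcal{U}}\le\|\Phi\|_{\mathcal{U}}\|T_1\|\cdots\|T_N\|$; (iii) $(z_1,\dots,z_N)\mapsto z_1\cdots z_N$ belongs to $\mathcal{U}(\mathbb{K}^N)$ (with $\mathbb{K}^N=\mathbb{K}\times\cdots\times\mathbb{K}$) and has $\mathcal{U}$-norm one. It is a Banach ideal if every $(\mathcal{U}(\mathbf{X}),\|\cdot\|_{\mathcal{U}})$ is complete. Stability: for $\mathbf{j}\subset\{1,\dots,N\}$ let $P_{\mathbf{j}}:\mathbf{X}\to\mathbf{X}$ be $P_{\mathbf{j}}(x_1,\dots,x_N)=(y_1,\dots,y_N)$ with $y_k=x_k$ if $k\in\mathbf{j}$ and $y_k=0$ if $k\notin\mathbf{j}$; $\mathbf{j}^c$ is the complement of $\mathbf{j}$ in $\{1,\dots,N\}$. For $\mathbf{a}=(a_1,\dots,a_N)\in\mathbf{X}$ define $V_{\mathbf{j},\mathbf{a}}:\mathcal{L}(^N\mathbf{X})\to\mathcal{L}(^N\mathbf{X})$ by $V_{\mathbf{j},\mathbf{a}}(\Phi)(\mathbf{x})=\Phi(P_{\mathbf{j}}(\mathbf{x})+P_{\mathbf{j}^c}(\mathbf{a}))\,\Phi(P_{\mathbf{j}}(\mathbf{a})+P_{\mathbf{j}^c}(\mathbf{x}))$. The ideal $\mathcal{U}$ is stable at $\mathbf{X}$ if there is $K>0$ such that for all $\mathbf{a}\in\mathbf{X}$, all $\mathbf{j}\subset\{1,\dots,N\}$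 and all $\Phi\in\mathcal{U}(\mathbf{X})$: $V_{\mathbf{j},\mathbf{a}}(\Phi)\in\mathcal{U}(\mathbf{X})$ and $\|V_{\mathbf{j},\mathbf{a}}(\Phi)\|_{\mathcal{U}}\le K\|\Phi\|_{\mathcal{U}}^2\|a_1\|\cdots\|a_N\|$. Arens extensions: for each permutation $\sigma$ of $\{1,\dots,N\}$, the corresponding Arens extension of $\Phi\in\mathcal{L}(^N\mathbf{X})$ is the $N$-linear form on $X_1''\times\cdots\times X_N''$ given by the iterated limit $\lim_{\alpha_{\sigma(1)}}\cdots\lim_{\alpha_{\sigma(N)}}\Phi(x_{1,\alpha_1},\dots,x_{N,\alpha_N})$ at $(x_1'',\dots,x_N'')$, where $(x_{j,\alpha_j})_{\alpha_j}\subset X_j$ is a bounded net $w^*$-convergent to $x_j''$. There are $N!$ of them, each with norm $\|\Phi\|$. They attain the supremum norm at the same $N$-tuple if there is a single $(a_1'',\dots,a_N'')\in B_{X_1''}\times\cdots\times B_{X_N''}$ at which each of the $N!$ Arens extensions has absolute value $\|\Phi\|$. *)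

theory Defs
  imports "HOL-Analysis.Analysis" "HOL-Algebra.Module" "HOL-Combinatorics.Permutations"
begin

text \<open>
  The factors of a tuple of Banach spaces are different spaces, and an ideal refers to all such
  tuples, so Banach spaces are structures with a carrier set. The scalar field is a set \<open>K\<close> of
  complex numbers, either \<open>\<real>\<close> or \<open>UNIV\<close>; scalar multiplication is relevant only for scalars in
  \<open>K\<close>. As everywhere in HOL-Algebra, the fields \<open>mult\<close> and \<open>one\<close> inherited by the record
  \<open>module\<close> play no role.
\<close>

record 'u normed_module = "(complex, 'u) module" +
  nrm :: "'u \<Rightarrow> real"

definition scalars :: "complex set \<Rightarrow> complex normed_module" where
  "scalars K = \<lparr>carrier = K, monoid.mult = (*), one = 1, zero = 0, add = (+), smult = (*), nrm = cmod\<rparr>"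

definition normed_space :: "complex set \<Rightarrow> 'u normed_module \<Rightarrow> bool" where
  "normed_space K X \<longleftrightarrow>
     module (scalars K) X \<and>
     (\<forall>x\<in>carrier X. 0 \<le> nrm X x \<and> (nrm X x = 0 \<longleftrightarrow> x = \<zero>\<^bsub>X\<^esub>)) \<and>
     (\<forall>c\<in>K. \<forall>x\<in>carrier X. nrm X (c \<odot>\<^bsub>X\<^esub> x) = cmod c * nrm X x) \<and>
     (\<forall>x\<in>carrier X. \<forall>y\<in>carrier X. nrm X (x \<oplus>\<^bsub>X\<^esub> y) \<le> nrm X x + nrm X y)"

text \<open>The locale \<open>Metric_space\<close> wants a distance that is nonnegative and symmetric off the
  carrier as well.\<close>

definition ndist :: "'u normed_module \<Rightarrow> 'u \<Rightarrow> 'u \<Rightarrow> real" where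
  "ndist X x y = (if x \<in> carrier X \<and> y \<in> carrier X then nrm X (x \<ominus>\<^bsub>X\<^esub> y) else 0)"

definition norm_topology :: "'u normed_module \<Rightarrow> 'u topology" where
  "norm_topology X = Metric_space.mtopology (carrier X) (ndist X)"

definition banach_space :: "complex set \<Rightarrow> 'u normed_module \<Rightarrow> bool" where
  "banach_space K X \<longleftrightarrow> normed_space K X \<and> Metric_space.mcomplete (carrier X) (ndist X)"

definition unit_ball :: "'u normed_module \<Rightarrow> 'u set" where
  "unit_ball X = {x \<in> carrier X. nrm X x \<le> 1}"

definition linear_map ::
  "complex set \<Rightarrow> 'u normed_module \<Rightarrow> 'v normed_module \<Rightarrow> ('u \<Rightarrow> 'v) \<Rightarrow> bool" where
  "linear_map K X Y T \<longleftrightarrow>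
     T \<in> carrier X \<rightarrow> carrier Y \<and>
     (\<forall>x\<in>carrier X. \<forall>y\<in>carrier X. T (x \<oplus>\<^bsub>X\<^esub> y) = T x \<oplus>\<^bsub>Y\<^esub> T y) \<and>
     (\<forall>c\<in>K. \<forall>x\<in>carrier X. T (c \<odot>\<^bsub>X\<^esub> x) = c \<odot>\<^bsub>Y\<^esub> T x)"

definition bounded_operator ::
  "complex set \<Rightarrow> 'u normed_module \<Rightarrow> 'v normed_module \<Rightarrow> ('u \<Rightarrow> 'v) \<Rightarrow> bool" where
  "bounded_operator K X Y T \<longleftrightarrow>
     linear_map K X Y T \<and> (\<exists>C. \<forall>x\<in>carrier X. nrm Y (T x) \<le> C * nrm X x)"

definition operator_norm :: "'u normed_module \<Rightarrow> 'v normed_module \<Rightarrow> ('u \<Rightarrow> 'v) \<Rightarrow> real" where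
  "operator_norm X Y T = (SUP x\<in>unit_ball X. nrm Y (T x))"

text \<open>Functionals and forms are total HOL functions; they are normalised to be \<open>0\<close> off their
  domain, so that equality of forms is equality of functions and the vector space operations are
  pointwise.\<close>

definition function_space :: "('p \<Rightarrow> complex) set \<Rightarrow> (('p \<Rightarrow> complex) \<Rightarrow> real) \<Rightarrow>
    ('p \<Rightarrow> complex) normed_module" where
  "function_space A n =
     \<lparr>carrier = A, monoid.mult = (\<lambda>f g p. f p * g p), one = (\<lambda>p. 1), zero = (\<lambda>p. 0),
      add = (\<lambda>f g p. f p + g p), smult = (\<lambda>c f p. c * f p), nrm = n\<rparr>"

definition dual :: "complex set \<Rightarrow> 'u normed_module \<Rightarrow> ('u \<Rightarrow> complex) normed_module" where
  "dual K X =
     function_space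
       {\<phi>. linear_map K X (scalars K) \<phi> \<and>
           continuous_map (norm_topology X) euclidean \<phi> \<and>
           (\<forall>x. x \<notin> carrier X \<longrightarrow> \<phi> x = 0)}
       (operator_norm X (scalars K))"

text \<open>A tuple of spaces is a family \<open>X\<close> of which only the members \<open>X 1, \<dots>, X N\<close> matter.\<close>

definition tuples :: "nat \<Rightarrow> (nat \<Rightarrow> 'u normed_module) \<Rightarrow> (nat \<Rightarrow> 'u) set" where
  "tuples N X = (\<Pi>\<^sub>E i\<in>{1..N}. carrier (X i))"

definition ball_tuples :: "nat \<Rightarrow> (nat \<Rightarrow> 'u normed_module) \<Rightarrow> (nat \<Rightarrow> 'u) set" where
  "ball_tuples N X = (\<Pi>\<^sub>E i\<in>{1..N}. unit_ball (X i))"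

definition sup_norm ::
  "nat \<Rightarrow> (nat \<Rightarrow> 'u normed_module) \<Rightarrow> ((nat \<Rightarrow> 'u) \<Rightarrow> complex) \<Rightarrow> real" where
  "sup_norm N X \<Phi> = (SUP x\<in>ball_tuples N X. cmod (\<Phi> x))"

definition forms ::
  "complex set \<Rightarrow> nat \<Rightarrow> (nat \<Rightarrow> 'u normed_module) \<Rightarrow> ((nat \<Rightarrow> 'u) \<Rightarrow> complex) set" where
  "forms K N X =
     {\<Phi>. (\<forall>x\<in>tuples N X. \<forall>i\<in>{1..N}. linear_map K (X i) (scalars K) (\<lambda>u. \<Phi> (x(i := u)))) \<and>
          continuous_map (product_topology (\<lambda>i. norm_topology (X i)) {1..N}) euclidean \<Phi> \<and>
          (\<forall>x. x \<notin> tuples N X \<longrightarrow> \<Phi> x = 0)}"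

definition form_space :: "complex set \<Rightarrow> nat \<Rightarrow> (nat \<Rightarrow> 'u normed_module) \<Rightarrow>
    ((nat \<Rightarrow> 'u) \<Rightarrow> complex) normed_module" where
  "form_space K N X = function_space (forms K N X) (sup_norm N X)"

definition compose_form :: "nat \<Rightarrow> (nat \<Rightarrow> 'v normed_module) \<Rightarrow>
    ((nat \<Rightarrow> 'u) \<Rightarrow> complex) \<Rightarrow> (nat \<Rightarrow> 'v \<Rightarrow> 'u) \<Rightarrow> (nat \<Rightarrow> 'v) \<Rightarrow> complex" where
  "compose_form N Z \<Phi> T =
     (\<lambda>z. if z \<in> tuples N Z then \<Phi> (\<lambda>i\<in>{1..N}. T i (z i)) else 0)"

text \<open>
  In an ideal, \<open>U X\<close> is the set of the members of the ideal that are forms on \<open>X\<close>, and \<open>nU X\<close> is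
  the ideal norm on it. HOL has no quantification over types, so ``all Banach spaces'' are those
  with carrier in the type \<open>complex + 'a\<close>, where \<open>'a\<close> is arbitrary: the right summand has room for
  any given tuple of Banach spaces, the left one contains the scalar field.
\<close>

definition scalar_copy :: "complex set \<Rightarrow> (complex + 'a) normed_module" where
  "scalar_copy K =
     \<lparr>carrier = Inl ` K, monoid.mult = (\<lambda>x y. Inl (projl x * projl y)), one = Inl 1, zero = Inl 0,
      add = (\<lambda>x y. Inl (projl x + projl y)), smult = (\<lambda>c x. Inl (c * projl x)),
      nrm = (\<lambda>x. cmod (projl x))\<rparr>"

definition product_form :: "complex set \<Rightarrow> nat \<Rightarrow> (nat \<Rightarrow> complex + 'a) \<Rightarrow> complex" where
  "product_form K N =
     (\<lambda>z. if z \<in> tuples N (\<lambda>i. scalar_copy K) then \<Prod>i\<in>{1..N}. projl (z i) else 0)"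

definition ideal_space :: "((nat \<Rightarrow> 'u normed_module) \<Rightarrow> ((nat \<Rightarrow> 'u) \<Rightarrow> complex) set) \<Rightarrow>
    ((nat \<Rightarrow> 'u normed_module) \<Rightarrow> ((nat \<Rightarrow> 'u) \<Rightarrow> complex) \<Rightarrow> real) \<Rightarrow>
    (nat \<Rightarrow> 'u normed_module) \<Rightarrow> ((nat \<Rightarrow> 'u) \<Rightarrow> complex) normed_module" where
  "ideal_space U nU X = function_space (U X) (nU X)"

definition normed_ideal :: "complex set \<Rightarrow> nat \<Rightarrow>
    ((nat \<Rightarrow> (complex + 'a) normed_module) \<Rightarrow> ((nat \<Rightarrow> complex + 'a) \<Rightarrow> complex) set) \<Rightarrow>
    ((nat \<Rightarrow> (complex + 'a) normed_module) \<Rightarrow> ((nat \<Rightarrow> complex + 'a) \<Rightarrow> complex) \<Rightarrow> real) \<Rightarrow>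
    bool" where
  "normed_ideal K N U nU \<longleftrightarrow>
     (\<forall>X. (\<forall>i\<in>{1..N}. banach_space K (X i)) \<longrightarrow>
        submodule (U X) (scalars K) (form_space K N X) \<and>
        normed_space K (ideal_space U nU X)) \<and>
     (\<forall>X Z T \<Phi>.
        (\<forall>i\<in>{1..N}. banach_space K (X i)) \<and> (\<forall>i\<in>{1..N}. banach_space K (Z i)) \<and>
        (\<forall>i\<in>{1..N}. bounded_operator K (Z i) (X i) (T i)) \<and> \<Phi> \<in> U X \<longrightarrow>
        compose_form N Z \<Phi> T \<in> U Z \<and>
        nU Z (compose_form N Z \<Phi> T)
          \<le> nU X \<Phi> * (\<Prod>i\<in>{1..N}. operator_norm (Z i) (X i) (T i))) \<and>
     product_form K N \<in> U (\<lambda>i. scalar_copy K) \<and>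
     nU (\<lambda>i. scalar_copy K) (product_form K N) = 1"

definition banach_ideal :: "complex set \<Rightarrow> nat \<Rightarrow>
    ((nat \<Rightarrow> (complex + 'a) normed_module) \<Rightarrow> ((nat \<Rightarrow> complex + 'a) \<Rightarrow> complex) set) \<Rightarrow>
    ((nat \<Rightarrow> (complex + 'a) normed_module) \<Rightarrow> ((nat \<Rightarrow> complex + 'a) \<Rightarrow> complex) \<Rightarrow> real) \<Rightarrow>
    bool" where
  "banach_ideal K N U nU \<longleftrightarrow>
     normed_ideal K N U nU \<and>
     (\<forall>X. (\<forall>i\<in>{1..N}. banach_space K (X i)) \<longrightarrow> banach_space K (ideal_space U nU X))"

definition proj :: "nat \<Rightarrow> (nat \<Rightarrow> 'u normed_module) \<Rightarrow> nat set \<Rightarrow> (nat \<Rightarrow> 'u) \<Rightarrow> nat \<Rightarrow> 'u" where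
  "proj N X J x = (\<lambda>k\<in>{1..N}. if k \<in> J then x k else \<zero>\<^bsub>X k\<^esub>)"

definition tuple_add ::
  "nat \<Rightarrow> (nat \<Rightarrow> 'u normed_module) \<Rightarrow> (nat \<Rightarrow> 'u) \<Rightarrow> (nat \<Rightarrow> 'u) \<Rightarrow> nat \<Rightarrow> 'u" where
  "tuple_add N X x y = (\<lambda>k\<in>{1..N}. x k \<oplus>\<^bsub>X k\<^esub> y k)"

definition V_form :: "nat \<Rightarrow> (nat \<Rightarrow> 'u normed_module) \<Rightarrow> nat set \<Rightarrow> (nat \<Rightarrow> 'u) \<Rightarrow>
    ((nat \<Rightarrow> 'u) \<Rightarrow> complex) \<Rightarrow> (nat \<Rightarrow> 'u) \<Rightarrow> complex" where
  "V_form N X J a \<Phi> =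
     (\<lambda>x. if x \<in> tuples N X
          then \<Phi> (tuple_add N X (proj N X J x) (proj N X ({1..N} - J) a)) *
               \<Phi> (tuple_add N X (proj N X J a) (proj N X ({1..N} - J) x))
          else 0)"

definition stable_at :: "nat \<Rightarrow>
    ((nat \<Rightarrow> 'u normed_module) \<Rightarrow> ((nat \<Rightarrow> 'u) \<Rightarrow> complex) set) \<Rightarrow>
    ((nat \<Rightarrow> 'u normed_module) \<Rightarrow> ((nat \<Rightarrow> 'u) \<Rightarrow> complex) \<Rightarrow> real) \<Rightarrow>
    (nat \<Rightarrow> 'u normed_module) \<Rightarrow> bool" where
  "stable_at N U nU X \<longleftrightarrow>
     (\<exists>C>0. \<forall>a\<in>tuples N X. \<forall>J\<subseteq>{1..N}. \<forall>\<Phi>\<in>U X.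
        V_form N X J a \<Phi> \<in> U X \<and>
        nU X (V_form N X J a \<Phi>) \<le> C * (nU X \<Phi>)\<^sup>2 * (\<Prod>i\<in>{1..N}. nrm (X i) (a i)))"

text \<open>Nets in \<open>X\<close> are represented by the (proper) filters of their tails. The following says that
  such a net is bounded and converges weak-star to the element \<open>\<xi>\<close> of the bidual.\<close>

definition bounded_wstar_net ::
  "complex set \<Rightarrow> 'u normed_module \<Rightarrow> (('u \<Rightarrow> complex) \<Rightarrow> complex) \<Rightarrow> 'u filter \<Rightarrow> bool" where
  "bounded_wstar_net K X \<xi> F \<longleftrightarrow>
     F \<noteq> bot \<and>
     (\<exists>M. eventually (\<lambda>x. x \<in> carrier X \<and> nrm X x \<le> M) F) \<and>
     (\<forall>\<phi>\<in>carrier (dual K X). (\<phi> \<longlongrightarrow> \<xi> \<phi>) F)"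

text \<open>The head of the list is the variable of the outermost limit.\<close>

primrec iterated_limit :: "nat list \<Rightarrow> (nat \<Rightarrow> 'u filter) \<Rightarrow> ((nat \<Rightarrow> 'u) \<Rightarrow> complex) \<Rightarrow>
    (nat \<Rightarrow> 'u) \<Rightarrow> complex" where
  "iterated_limit [] F \<Phi> x = \<Phi> x"
| "iterated_limit (j # js) F \<Phi> x = Lim (F j) (\<lambda>u. iterated_limit js F \<Phi> (x(j := u)))"

text \<open>The iterated limit \<open>lim\<^bsub>\<sigma>(1)\<^esub> \<dots> lim\<^bsub>\<sigma>(N)\<^esub>\<close> does not depend on the nets chosen, which exist by
  Goldstine's theorem; the extension is that common value. Every coordinate of the
  initial tuple is overwritten.\<close>

definition arens_extension :: "complex set \<Rightarrow> nat \<Rightarrow> (nat \<Rightarrow> 'u normed_module) \<Rightarrow>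
    (nat \<Rightarrow> nat) \<Rightarrow> ((nat \<Rightarrow> 'u) \<Rightarrow> complex) \<Rightarrow> (nat \<Rightarrow> ('u \<Rightarrow> complex) \<Rightarrow> complex) \<Rightarrow>
    complex" where
  "arens_extension K N X \<sigma> \<Phi> \<xi> =
     (THE l. \<forall>F. (\<forall>j\<in>{1..N}. bounded_wstar_net K (X j) (\<xi> j) (F j)) \<longrightarrow>
        iterated_limit (map \<sigma> [1..<Suc N]) F \<Phi> (\<lambda>_. undefined) = l)"

definition arens_extensions_attain ::
  "complex set \<Rightarrow> nat \<Rightarrow> (nat \<Rightarrow> 'u normed_module) \<Rightarrow> ((nat \<Rightarrow> 'u) \<Rightarrow> complex) \<Rightarrow> bool" where
  "arens_extensions_attain K N X \<Phi> \<longleftrightarrow>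
     (\<exists>\<xi>\<in>ball_tuples N (\<lambda>i. dual K (dual K (X i))).
        \<forall>\<sigma>. \<sigma> permutes {1..N} \<longrightarrow> cmod (arens_extension K N X \<sigma> \<Phi> \<xi>) = sup_norm N X \<Phi>)"

end

theory Submission
  imports Defs
begin

text \<open>
  The argument is Lindenstrauss's iteration. With \<open>W a \<Phi>\<close> (\<open>V_sum\<close>) the sum of the forms \<open>V\<^bsub>J,a\<^esub> \<Phi>\<close> over all
  \<open>J \<subseteq> {1..N}\<close>, put \<open>\<Phi>\<^sub>n\<^sub>+\<^sub>1 = \<Phi>\<^sub>n + \<epsilon>\<^sub>n \<theta>\<^sub>n W a\<^sub>n \<Phi>\<^sub>n\<close>, where \<open>a\<^sub>n\<close> almost attains the norm of \<open>\<Phi>\<^sub>n\<close> and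
  the phase \<open>\<theta>\<^sub>n\<close> makes the perturbation add up at \<open>a\<^sub>n\<close>; this is possible for all \<open>J\<close> at once because
  \<open>V\<^bsub>J,a\<^esub> \<Phi>\<close> has the value \<open>(\<Phi> a)\<^sup>2\<close> at \<open>a\<close>. If \<open>x\<close> almost attains the norm of \<open>\<Phi>\<^sub>n\<^sub>+\<^sub>1\<close>, no summand can be
  small at \<open>x\<close>, so replacing any set of coordinates of \<open>x\<close> by those of \<open>a\<^sub>n\<close> gives a tuple that almost
  attains the norm of \<open>\<Phi>\<^sub>n\<close>. By downward induction every tuple whose coordinates are taken from
  arbitrary members of \<open>a\<^sub>n, a\<^sub>n\<^sub>+\<^sub>1, \<dots>\<close> almost attains the norm of the limit form, uniformly as
  \<open>n\<close> grows. Weak-star cluster points of the coordinate sequences therefore give one point of the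
  bidual at which every iterated limit has maximal modulus.
\<close>

section \<open>Normed spaces over the scalar field and their duals\<close>

lemma scalars_simps [simp]:
  "carrier (scalars K) = K" "\<zero>\<^bsub>scalars K\<^esub> = 0" "\<one>\<^bsub>scalars K\<^esub> = 1"
  "x \<oplus>\<^bsub>scalars K\<^esub> y = x + y" "x \<otimes>\<^bsub>scalars K\<^esub> y = x * y"
  "c \<odot>\<^bsub>scalars K\<^esub> x = c * x" "nrm (scalars K) = cmod"
  by (simp_all add: scalars_def)

lemma function_space_simps [simp]:
  "carrier (function_space A n) = A" "\<zero>\<^bsub>function_space A n\<^esub> = (\<lambda>p. 0)"
  "f \<oplus>\<^bsub>function_space A n\<^esub> g = (\<lambda>p. f p + g p)"
  "c \<odot>\<^bsub>function_space A n\<^esub> f = (\<lambda>p. c * f p)" "nrm (function_space A n) = n"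
  by (simp_all add: function_space_def)

locale scalar_field =
  fixes K :: "complex set"
  assumes real_or_complex: "K = \<real> \<or> K = UNIV"
begin

text \<open>Closure under \<open>cnj\<close> and \<open>sgn\<close> is included because the phase
  factor \<open>cnj (sgn (\<Phi> a))\<close> of the perturbation has to be a scalar of
  \<open>K\<close>, also in the real case.\<close>

lemma scalar_closed [intro, simp]:
  "0 \<in> K" "1 \<in> K" "complex_of_real r \<in> K"
  "x \<in> K \<Longrightarrow> y \<in> K \<Longrightarrow> x + y \<in> K" "x \<in> K \<Longrightarrow> y \<in> K \<Longrightarrow> x * y \<in> K"
  "x \<in> K \<Longrightarrow> - x \<in> K" "x \<in> K \<Longrightarrow> inverse x \<in> K" "x \<in> K \<Longrightarrow> cnj x \<in> K" "x \<in> K \<Longrightarrow> sgn x \<in> K"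
  using real_or_complex by (auto simp: Reals_cnj_iff sgn_div_norm scaleR_conv_of_real)

lemma closed_scalars: "closed K"
  using real_or_complex closed_complex_Reals by auto

lemma cring_scalars: "cring (scalars K)"
proof (rule cringI)
  show "abelian_group (scalars K)"
    by (rule abelian_groupI) (auto intro: exI[of _ "- x" for x] bexI[of _ "- x" for x])
  show "comm_monoid (scalars K)"
    by (rule comm_monoidI) auto
qed (auto simp: algebra_simps)

lemma module_function_space:
  assumes "(\<lambda>p. 0) \<in> A" "\<And>f g. f \<in> A \<Longrightarrow> g \<in> A \<Longrightarrow> (\<lambda>p. f p + g p) \<in> A"
    and "\<And>c f. c \<in> K \<Longrightarrow> f \<in> A \<Longrightarrow> (\<lambda>p. c * f p) \<in> A"
  shows "module (scalars K) (function_space A n)"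
proof (rule moduleI[OF cring_scalars])
  show "abelian_group (function_space A n)"
  proof (rule abelian_groupI)
    fix f assume "f \<in> carrier (function_space A n)"
    then have "(\<lambda>p. (- 1) * f p) \<in> A"
      by (intro assms(3)) auto
    then show "\<exists>g\<in>carrier (function_space A n).
        g \<oplus>\<^bsub>function_space A n\<^esub> f = \<zero>\<^bsub>function_space A n\<^esub>"
      by (auto intro!: bexI[of _ "\<lambda>p. (- 1) * f p"])
  qed (auto simp: assms add.assoc add.commute)
qed (auto simp: assms algebra_simps)

end

section \<open>Normed spaces as metric spaces\<close>

locale normed_space_over = scalar_field +
  fixes X :: "'u normed_module"
  assumes normed_space: "normed_space K X"
begin

sublocale module "scalars K" X
  using normed_space by (simp add: normed_space_def)

lemma nrm_nonneg [simp]: "x \<in> carrier X \<Longrightarrow> 0 \<le> nrm X x"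
  and nrm_eq_0_iff: "x \<in> carrier X \<Longrightarrow> nrm X x = 0 \<longleftrightarrow> x = \<zero>\<^bsub>X\<^esub>"
  and nrm_smult: "c \<in> K \<Longrightarrow> x \<in> carrier X \<Longrightarrow> nrm X (c \<odot>\<^bsub>X\<^esub> x) = cmod c * nrm X x"
  and nrm_triangle: "x \<in> carrier X \<Longrightarrow> y \<in> carrier X \<Longrightarrow> nrm X (x \<oplus>\<^bsub>X\<^esub> y) \<le> nrm X x + nrm X y"
  using normed_space by (auto simp: normed_space_def)

lemma smult_carrier [simp]: "c \<in> K \<Longrightarrow> x \<in> carrier X \<Longrightarrow> c \<odot>\<^bsub>X\<^esub> x \<in> carrier X"
  using smult_closed by simp

lemma nrm_zero [simp]: "nrm X \<zero>\<^bsub>X\<^esub> = 0"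
  by (simp add: nrm_eq_0_iff)

lemma smult_minus_one: "x \<in> carrier X \<Longrightarrow> (- 1) \<odot>\<^bsub>X\<^esub> x = \<ominus>\<^bsub>X\<^esub> x"
proof -
  assume x: "x \<in> carrier X"
  have "(- 1) \<odot>\<^bsub>X\<^esub> x \<oplus>\<^bsub>X\<^esub> x = ((- 1) \<oplus>\<^bsub>scalars K\<^esub> 1) \<odot>\<^bsub>X\<^esub> x"
    using x smult_l_distr[of "- 1" 1 x] smult_one[of x] by simp
  also have "\<dots> = \<zero>\<^bsub>X\<^esub>"
    using x smult_l_null[of x] by simp
  finally show ?thesis
    using x by (intro minus_equality[symmetric]) auto
qed

lemma nrm_minus: "x \<in> carrier X \<Longrightarrow> nrm X (\<ominus>\<^bsub>X\<^esub> x) = nrm X x"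
  using nrm_smult[of "- 1" x] by (simp add: smult_minus_one)

lemma minus_swap: "x \<in> carrier X \<Longrightarrow> y \<in> carrier X \<Longrightarrow> \<ominus>\<^bsub>X\<^esub> (x \<ominus>\<^bsub>X\<^esub> y) = y \<ominus>\<^bsub>X\<^esub> x"
  by (simp add: a_minus_def minus_add a_comm)

sublocale metric: Metric_space "carrier X" "ndist X"
proof
  fix x y z
  show "0 \<le> ndist X x y"
    by (auto simp: ndist_def)
  show "ndist X x y = ndist X y x"
    by (auto simp: ndist_def) (metis minus_closed minus_swap nrm_minus)
  assume xy: "x \<in> carrier X" "y \<in> carrier X"
  then show "ndist X x y = 0 \<longleftrightarrow> x = y"
    by (auto simp: ndist_def nrm_eq_0_iff a_minus_def r_neg)
      (metis a_inv_closed minus_equality minus_minus)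
  assume z: "z \<in> carrier X"
  have "x \<ominus>\<^bsub>X\<^esub> z = (x \<ominus>\<^bsub>X\<^esub> y) \<oplus>\<^bsub>X\<^esub> (y \<ominus>\<^bsub>X\<^esub> z)"
    using xy z by (simp add: a_minus_def a_assoc l_neg r_neg flip: a_assoc) (simp add: a_assoc l_neg)
  then show "ndist X x z \<le> ndist X x y + ndist X y z"
    using xy z nrm_triangle[of "x \<ominus>\<^bsub>X\<^esub> y" "y \<ominus>\<^bsub>X\<^esub> z"] by (simp add: ndist_def)
qed

lemma zero_in_unit_ball [simp]: "\<zero>\<^bsub>X\<^esub> \<in> unit_ball X"
  by (simp add: unit_ball_def)

end

section \<open>Continuity, boundedness and the operator norm of functionals\<close>

lemma linear_mapD:
  assumes "linear_map K X Y T"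
  shows "x \<in> carrier X \<Longrightarrow> T x \<in> carrier Y"
    and "x \<in> carrier X \<Longrightarrow> y \<in> carrier X \<Longrightarrow> T (x \<oplus>\<^bsub>X\<^esub> y) = T x \<oplus>\<^bsub>Y\<^esub> T y"
    and "c \<in> K \<Longrightarrow> x \<in> carrier X \<Longrightarrow> T (c \<odot>\<^bsub>X\<^esub> x) = c \<odot>\<^bsub>Y\<^esub> T x"
  using assms by (auto simp: linear_map_def)

context normed_space_over
begin

lemma linear_functional_zero:
  assumes "linear_map K X (scalars K) \<phi>"
  shows "\<phi> \<zero>\<^bsub>X\<^esub> = 0"
  using linear_mapD(2)[OF assms, of "\<zero>\<^bsub>X\<^esub>" "\<zero>\<^bsub>X\<^esub>"] by simp

lemma linear_functional_minus:
  assumes "linear_map K X (scalars K) \<phi>" "x \<in> carrier X" "y \<in> carrier X"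
  shows "\<phi> (x \<ominus>\<^bsub>X\<^esub> y) = \<phi> x - \<phi> y"
  using linear_mapD(2)[OF assms(1), of x "\<ominus>\<^bsub>X\<^esub> y"] linear_mapD(3)[OF assms(1), of "- 1" y] assms
  by (simp add: a_minus_def smult_minus_one)

lemma bounded_functional_continuous:
  assumes lin: "linear_map K X (scalars K) \<phi>"
    and bd: "\<And>x. x \<in> carrier X \<Longrightarrow> cmod (\<phi> x) \<le> C * nrm X x"
  shows "continuous_map (norm_topology X) euclidean \<phi>"
  unfolding norm_topology_def metric.continuous_map_from_metric
proof (intro conjI ballI allI impI)
  show "\<phi> \<in> carrier X \<rightarrow> topspace euclidean"
    by simp
  fix a U assume a: "a \<in> carrier X" and "openin euclidean U \<and> \<phi> a \<in> U"
  then obtain e where e: "e > 0" "ball (\<phi> a) e \<subseteq> U"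
    by (metis open_contains_ball open_openin)
  \<comment> \<open>\<open>C\<close> has no prescribed sign and may be 0;
    \<open>\<bar>C\<bar> + 1\<close> is a positive bound in its place.\<close>
  define r where "r = e / (\<bar>C\<bar> + 1)"
  have "r > 0" using e by (simp add: r_def)
  moreover have "\<phi> x \<in> U" if x: "x \<in> carrier X \<and> ndist X a x < r" for x
  proof -
    have "cmod (\<phi> a - \<phi> x) \<le> C * nrm X (a \<ominus>\<^bsub>X\<^esub> x)"
      using bd[of "a \<ominus>\<^bsub>X\<^esub> x"] a x lin by (simp add: linear_functional_minus)
    also have "\<dots> \<le> (\<bar>C\<bar> + 1) * nrm X (a \<ominus>\<^bsub>X\<^esub> x)"
      using a x by (intro mult_right_mono) auto
    also have "\<dots> < (\<bar>C\<bar> + 1) * r"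
      using x a by (intro mult_strict_left_mono) (auto simp: ndist_def)
    also have "\<dots> = e" by (simp add: r_def)
    finally show ?thesis using e(2) by (auto simp: dist_norm)
  qed
  ultimately show "\<exists>r>0. \<forall>x. x \<in> carrier X \<and> ndist X a x < r \<longrightarrow> \<phi> x \<in> U"
    by blast
qed

lemma continuous_functional_bounded:
  assumes lin: "linear_map K X (scalars K) \<phi>"
    and cont: "continuous_map (norm_topology X) euclidean \<phi>"
  obtains C where "0 \<le> C" "\<And>x. x \<in> carrier X \<Longrightarrow> cmod (\<phi> x) \<le> C * nrm X x"
proof -
  have "\<phi> \<zero>\<^bsub>X\<^esub> \<in> ball 0 1" "openin euclidean (ball (0::complex) 1)"
    using linear_functional_zero[OF lin] by (auto simp: open_openin[symmetric])
  then obtain r where r: "r > 0" "\<And>x. x \<in> carrier X \<Longrightarrow> ndist X \<zero>\<^bsub>X\<^esub> x < r \<Longrightarrow> \<phi> x \<in> ball 0 1"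
    using cont unfolding norm_topology_def metric.continuous_map_from_metric
    by (metis zero_closed)
  have "cmod (\<phi> x) \<le> (2 / r) * nrm X x" if x: "x \<in> carrier X" for x
  proof (cases "nrm X x = 0")
    case True
    then show ?thesis
      using x linear_functional_zero[OF lin] by (simp add: nrm_eq_0_iff)
  next
    case False
    then have pos: "nrm X x > 0" using nrm_nonneg[OF x] by linarith
    \<comment> \<open>Scaling \<open>x\<close> to norm \<open>r / 2\<close> puts it into the ball on
      which \<open>\<phi>\<close> has modulus below 1; homogeneity then gives the constant
      \<open>2 / r\<close>.\<close>
    define t where "t = r / (2 * nrm X x)"
    have t: "t > 0" using pos r by (simp add: t_def)
    have "ndist X \<zero>\<^bsub>X\<^esub> (complex_of_real t \<odot>\<^bsub>X\<^esub> x) = t * nrm X x"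
      using x t by (simp add: ndist_def a_minus_def nrm_minus nrm_smult)
    also have "\<dots> < r" using pos r by (simp add: t_def)
    finally have "\<phi> (complex_of_real t \<odot>\<^bsub>X\<^esub> x) \<in> ball 0 1"
      using x by (intro r(2)) auto
    then have "t * cmod (\<phi> x) < 1"
      using x t linear_mapD(3)[OF lin, of "complex_of_real t" x] by (simp add: norm_mult)
    then have "cmod (\<phi> x) \<le> 1 / t"
      using t by (simp add: field_simps)
    then show ?thesis by (simp add: t_def mult.commute)
  qed
  then show thesis
    using r(1) by (intro that[of "2 / r"]) auto
qed

end

lemma (in normed_space_over) operator_norm_scalars:
  assumes lin: "linear_map K X (scalars K) \<phi>"
    and cont: "continuous_map (norm_topology X) euclidean \<phi>"
  shows functional_le_operator_norm:
      "x \<in> carrier X \<Longrightarrow> cmod (\<phi> x) \<le> operator_norm X (scalars K) \<phi> * nrm X x"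
    and operator_norm_nonneg: "0 \<le> operator_norm X (scalars K) \<phi>"
proof -
  obtain C where C: "0 \<le> C" "\<And>x. x \<in> carrier X \<Longrightarrow> cmod (\<phi> x) \<le> C * nrm X x"
    using continuous_functional_bounded[OF assms] by blast
  \<comment> \<open>A real supremum can be compared with its terms only if it is over a bounded set;
    continuity of \<open>\<phi>\<close> provides the bound.\<close>
  have bdd: "bdd_above ((\<lambda>x. nrm (scalars K) (\<phi> x)) ` unit_ball X)"
  proof (intro bdd_aboveI2)
    fix x assume "x \<in> unit_ball X"
    then show "nrm (scalars K) (\<phi> x) \<le> C"
      using C(2)[of x] C(1) mult_left_mono[of "nrm X x" 1 C] by (auto simp: unit_ball_def)
  qed
  have ub: "cmod (\<phi> x) \<le> operator_norm X (scalars K) \<phi>" if "x \<in> unit_ball X" for x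
    using cSUP_upper[OF that bdd] by (simp add: operator_norm_def)
  show "0 \<le> operator_norm X (scalars K) \<phi>"
    using order_trans[OF norm_ge_zero ub[of "\<zero>\<^bsub>X\<^esub>"]] by simp
  assume x: "x \<in> carrier X"
  show "cmod (\<phi> x) \<le> operator_norm X (scalars K) \<phi> * nrm X x"
  proof (cases "nrm X x = 0")
    case True
    then show ?thesis
      using x linear_functional_zero[OF lin] by (simp add: nrm_eq_0_iff)
  next
    case False
    then have pos: "nrm X x > 0" using nrm_nonneg[OF x] by linarith
    have "complex_of_real (1 / nrm X x) \<odot>\<^bsub>X\<^esub> x \<in> unit_ball X"
      using x pos nrm_smult[of "complex_of_real (1 / nrm X x)" x]
        smult_carrier[of "complex_of_real (1 / nrm X x)" x] scalar_closed(3)[of "1 / nrm X x"]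
      by (simp add: unit_ball_def norm_divide del: of_real_divide)
    from ub[OF this] have "cmod (\<phi> x) / nrm X x \<le> operator_norm X (scalars K) \<phi>"
      using x pos linear_mapD(3)[OF lin scalar_closed(3)[of "1 / nrm X x"] x] by (simp add: norm_mult norm_divide)
    then show ?thesis using pos by (simp add: field_simps)
  qed
qed

lemma (in normed_space_over) operator_norm_le:
  assumes "0 \<le> C" "\<And>x. x \<in> carrier X \<Longrightarrow> nrm Y (T x) \<le> C * nrm X x"
  shows "operator_norm X Y T \<le> C"
  unfolding operator_norm_def
proof (rule cSUP_least)
  show "unit_ball X \<noteq> {}" using zero_in_unit_ball by blast
  fix x assume "x \<in> unit_ball X"
  then show "nrm Y (T x) \<le> C"
    using assms(2)[of x] assms(1) mult_left_mono[of "nrm X x" 1 C] by (auto simp: unit_ball_def)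
qed

section \<open>The dual as a normed space, and weak-star cluster points\<close>

lemma dual_carrier_iff:
  "\<phi> \<in> carrier (dual K X) \<longleftrightarrow> linear_map K X (scalars K) \<phi> \<and>
     continuous_map (norm_topology X) euclidean \<phi> \<and> (\<forall>x. x \<notin> carrier X \<longrightarrow> \<phi> x = 0)"
  by (simp add: dual_def)

lemma dual_simps [simp]:
  "\<zero>\<^bsub>dual K X\<^esub> = (\<lambda>p. 0)" "f \<oplus>\<^bsub>dual K X\<^esub> g = (\<lambda>p. f p + g p)"
  "c \<odot>\<^bsub>dual K X\<^esub> f = (\<lambda>p. c * f p)" "nrm (dual K X) = operator_norm X (scalars K)"
  by (simp_all add: dual_def)

context normed_space_over
begin

lemma dual_carrierI:
  assumes "linear_map K X (scalars K) \<phi>" "\<And>x. x \<notin> carrier X \<Longrightarrow> \<phi> x = 0"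
    "\<And>x. x \<in> carrier X \<Longrightarrow> cmod (\<phi> x) \<le> C * nrm X x"
  shows "\<phi> \<in> carrier (dual K X)"
  using assms bounded_functional_continuous by (auto simp: dual_carrier_iff)

lemma dual_bound:
  assumes "\<phi> \<in> carrier (dual K X)" "x \<in> carrier X"
  shows "cmod (\<phi> x) \<le> nrm (dual K X) \<phi> * nrm X x"
  using assms functional_le_operator_norm by (auto simp: dual_carrier_iff)

lemma dual_nrm_nonneg: "\<phi> \<in> carrier (dual K X) \<Longrightarrow> 0 \<le> nrm (dual K X) \<phi>"
  using operator_norm_nonneg by (auto simp: dual_carrier_iff)

lemma dual_nrm_le:
  "0 \<le> C \<Longrightarrow> (\<And>x. x \<in> carrier X \<Longrightarrow> cmod (\<phi> x) \<le> C * nrm X x) \<Longrightarrow> nrm (dual K X) \<phi> \<le> C"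
  using operator_norm_le[of C "scalars K" \<phi>] by simp

lemma dual_linear:
  assumes "\<phi> \<in> carrier (dual K X)"
  shows "linear_map K X (scalars K) \<phi>" "x \<notin> carrier X \<Longrightarrow> \<phi> x = 0"
  using assms by (auto simp: dual_carrier_iff)

lemma dual_add_closed:
  assumes f: "f \<in> carrier (dual K X)" and g: "g \<in> carrier (dual K X)"
  shows "(\<lambda>x. f x + g x) \<in> carrier (dual K X)"
    and "nrm (dual K X) (\<lambda>x. f x + g x) \<le> nrm (dual K X) f + nrm (dual K X) g"
proof -
  have bd: "cmod (f x + g x) \<le> (nrm (dual K X) f + nrm (dual K X) g) * nrm X x"
    if x: "x \<in> carrier X" for x
    using norm_triangle_ineq[of "f x" "g x"] dual_bound[OF f x] dual_bound[OF g x]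
    by (simp add: distrib_right)
  show "(\<lambda>x. f x + g x) \<in> carrier (dual K X)"
    using f g linear_mapD[OF dual_linear(1)[OF f]] linear_mapD[OF dual_linear(1)[OF g]]
    by (intro dual_carrierI[OF _ _ bd])
      (auto simp: linear_map_def dual_linear(2) algebra_simps)
  show "nrm (dual K X) (\<lambda>x. f x + g x) \<le> nrm (dual K X) f + nrm (dual K X) g"
    using bd f g by (intro dual_nrm_le add_nonneg_nonneg dual_nrm_nonneg) auto
qed

lemma dual_smult_closed:
  assumes c: "c \<in> K" and f: "f \<in> carrier (dual K X)"
  shows "(\<lambda>x. c * f x) \<in> carrier (dual K X)"
    and "nrm (dual K X) (\<lambda>x. c * f x) \<le> cmod c * nrm (dual K X) f"
proof -
  have bd: "cmod (c * f x) \<le> (cmod c * nrm (dual K X) f) * nrm X x" if x: "x \<in> carrier X" for x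
    using mult_left_mono[OF dual_bound[OF f x], of "cmod c"] by (simp add: norm_mult mult.assoc)
  show "(\<lambda>x. c * f x) \<in> carrier (dual K X)"
    using c f linear_mapD[OF dual_linear(1)[OF f]]
    by (intro dual_carrierI[OF _ _ bd]) (auto simp: linear_map_def dual_linear(2) algebra_simps)
  show "nrm (dual K X) (\<lambda>x. c * f x) \<le> cmod c * nrm (dual K X) f"
    using bd f by (intro dual_nrm_le mult_nonneg_nonneg dual_nrm_nonneg) auto
qed

text \<open>With this, every fact about duals applies again to \<open>dual K X\<close> and so to the
  bidual.\<close>

lemma normed_space_dual: "normed_space K (dual K X)"
  unfolding normed_space_def
proof (intro conjI ballI)
  have zero: "(\<lambda>x. 0) \<in> carrier (dual K X)"
    by (rule dual_carrierI[where C = 0]) (auto simp: linear_map_def)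
  then show "module (scalars K) (dual K X)"
    using dual_add_closed(1) dual_smult_closed(1)
    unfolding dual_def by (intro module_function_space) auto
  fix f assume f: "f \<in> carrier (dual K X)"
  show "0 \<le> nrm (dual K X) f"
    using f by (rule dual_nrm_nonneg)
  show "nrm (dual K X) f = 0 \<longleftrightarrow> f = \<zero>\<^bsub>dual K X\<^esub>"
  proof
    assume "nrm (dual K X) f = 0"
    then have "f x = 0" for x
      using dual_bound[OF f, of x] dual_linear(2)[OF f, of x] by fastforce
    then show "f = \<zero>\<^bsub>dual K X\<^esub>" by auto
  next
    assume "f = \<zero>\<^bsub>dual K X\<^esub>"
    then show "nrm (dual K X) f = 0"
      using dual_nrm_le[of 0 f] dual_nrm_nonneg[OF f] by simp
  qed
  {
    fix g assume g: "g \<in> carrier (dual K X)"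
    show "nrm (dual K X) (f \<oplus>\<^bsub>dual K X\<^esub> g) \<le> nrm (dual K X) f + nrm (dual K X) g"
      using dual_add_closed(2)[OF f g] by simp
  next
    fix c assume c: "c \<in> K"
    \<comment> \<open>The converse of \<open>dual_smult_closed(2)\<close> comes from applying that
      estimate to the scalar \<open>inverse c\<close> and the functional \<open>c f\<close>.\<close>
    have "cmod c * nrm (dual K X) f \<le> nrm (dual K X) (\<lambda>x. c * f x)"
    proof (cases "c = 0")
      case False
      have "nrm (dual K X) f \<le> cmod (inverse c) * nrm (dual K X) (\<lambda>x. c * f x)"
        using dual_smult_closed(2)[OF scalar_closed(7)[OF c] dual_smult_closed(1)[OF c f]] False
        by (simp flip: mult.assoc)
      then show ?thesis using False by (simp add: norm_divide field_simps)
    qed (use dual_nrm_nonneg[OF dual_smult_closed(1)[OF c f]] in simp)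
    then show "nrm (dual K X) (c \<odot>\<^bsub>dual K X\<^esub> f) = cmod c * nrm (dual K X) f"
      using dual_smult_closed(2)[OF c f] by simp
  }
qed

text \<open>Banach-Alaoglu by Tychonoff: the evaluations at \<open>a n\<close> lie in a product of
  compact discs and so have a cluster point there. The filter \<open>F\<close> on the indices takes
  the place of a convergent subnet.\<close>

lemma weak_star_cluster:
  assumes a: "\<And>n. a n \<in> unit_ball X"
  obtains \<xi> F where "\<xi> \<in> unit_ball (dual K (dual K X))" "F \<noteq> bot" "F \<le> sequentially"
    "\<And>\<phi>. \<phi> \<in> carrier (dual K X) \<Longrightarrow> cmod (\<xi> \<phi>) \<le> nrm (dual K X) \<phi>"
    "\<And>\<phi>. \<phi> \<in> carrier (dual K X) \<Longrightarrow> ((\<lambda>n. \<phi> (a n)) \<longlongrightarrow> \<xi> \<phi>) F"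
proof -
  let ?D = "carrier (dual K X)"
  define p where "p n \<phi> = (if \<phi> \<in> ?D then \<phi> (a n) else 0)" for n \<phi>
  \<comment> \<open>Intersecting with the closed set \<open>K\<close> makes the cluster point
    \<open>K\<close>-valued. Off the dual the factor is \<open>{0}\<close>, which gives
    \<open>\<xi>\<close> the value 0 that membership in the bidual demands.\<close>
  define B where "B \<phi> = (if \<phi> \<in> ?D then cball (0::complex) (nrm (dual K X) \<phi>) \<inter> K else {0})" for \<phi>
  have "compactin (product_topology (\<lambda>_. euclidean) UNIV) (Pi\<^sub>E UNIV B)"
    by (auto simp: compactin_PiE B_def compactin_euclidean_iff closed_scalars compact_Int_closed)
  then have comp: "compact (Pi\<^sub>E UNIV B)"
    by (simp add: euclidean_product_topology compactin_euclidean_iff)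
  have bd: "cmod (\<phi> (a n)) \<le> nrm (dual K X) \<phi>" if \<phi>: "\<phi> \<in> ?D" for \<phi> n
    using dual_bound[OF \<phi>, of "a n"] a[of n] dual_nrm_nonneg[OF \<phi>]
      mult_left_mono[of "nrm X (a n)" 1 "nrm (dual K X) \<phi>"] by (auto simp: unit_ball_def)
  have p: "p n \<in> Pi\<^sub>E UNIV B" for n
    using bd a linear_mapD(1)[OF dual_linear(1)] by (auto simp: p_def B_def unit_ball_def)
  obtain \<xi> where \<xi>: "\<xi> \<in> Pi\<^sub>E UNIV B" and ninf: "inf (nhds \<xi>) (filtermap p sequentially) \<noteq> bot"
    using comp[unfolded compact_filter, rule_format, of "filtermap p sequentially"] p
    by (auto simp: filtermap_bot_iff eventually_filtermap)
  \<comment> \<open>Generated by the tails of the index set and the index sets on which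
    \<open>p\<close> is near \<open>\<xi>\<close>, so that \<open>p\<close> converges to
    \<open>\<xi>\<close> along it.\<close>
  define F where "F = inf sequentially (filtercomap p (nhds \<xi>))"
  \<comment> \<open>Otherwise some tail of \<open>p\<close> would avoid a neighbourhood of
    \<open>\<xi>\<close>, against the choice of \<open>\<xi>\<close> as a cluster point.\<close>
  have "F \<noteq> bot"
  proof
    assume "F = bot"
    then obtain P Q where P: "eventually P sequentially" and Q: "eventually Q (nhds \<xi>)"
      and PQ: "\<And>n. P n \<Longrightarrow> \<not> Q (p n)"
      unfolding F_def trivial_limit_def eventually_inf eventually_filtercomap by blast
    have "eventually (\<lambda>y. \<exists>n. P n \<and> y = p n) (filtermap p sequentially)"
      using P by (auto simp: eventually_filtermap elim: eventually_mono)
    with Q have "eventually (\<lambda>_. False) (inf (nhds \<xi>) (filtermap p sequentially))"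
      unfolding eventually_inf using PQ by blast
    then show False using ninf by (simp add: trivial_limit_def)
  qed
  have "F \<le> sequentially" by (simp add: F_def)
  have "filterlim p (nhds \<xi>) F"
    unfolding F_def by (rule filterlim_mono[OF filterlim_filtercomap order_refl inf_le2])
  then have lim: "((\<lambda>n. p n \<phi>) \<longlongrightarrow> \<xi> \<phi>) F" for \<phi>
    using continuous_on_tendsto_compose[OF continuous_on_product_coordinates[of \<phi>], of p \<xi> F] by simp
  have conv: "((\<lambda>n. \<phi> (a n)) \<longlongrightarrow> \<xi> \<phi>) F" if "\<phi> \<in> ?D" for \<phi>
    using lim[of \<phi>] that by (simp add: p_def)
  have \<xi>B: "\<xi> \<phi> \<in> B \<phi>" for \<phi>
    using \<xi> by auto
  have bound: "cmod (\<xi> \<phi>) \<le> nrm (dual K X) \<phi>" "\<xi> \<phi> \<in> K" if "\<phi> \<in> ?D" for \<phi>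
    using \<xi>B[of \<phi>] that by (auto simp: B_def)
  interpret D: normed_space_over K "dual K X"
    by unfold_locales (rule normed_space_dual)
  \<comment> \<open>Linearity survives because limits along the proper filter \<open>F\<close> are
    unique.\<close>
  have "linear_map K (dual K X) (scalars K) \<xi>"
    unfolding linear_map_def
  proof (intro conjI ballI)
    fix f assume f: "f \<in> ?D"
    {
      fix g assume g: "g \<in> ?D"
      show "\<xi> (f \<oplus>\<^bsub>dual K X\<^esub> g) = \<xi> f \<oplus>\<^bsub>scalars K\<^esub> \<xi> g"
        using tendsto_unique[OF \<open>F \<noteq> bot\<close> conv[OF dual_add_closed(1)[OF f g]] tendsto_add[OF conv[OF f] conv[OF g]]]
        by simp
    next
      fix c assume c: "c \<in> K"
      show "\<xi> (c \<odot>\<^bsub>dual K X\<^esub> f) = c \<odot>\<^bsub>scalars K\<^esub> \<xi> f"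
        using tendsto_unique[OF \<open>F \<noteq> bot\<close> conv[OF dual_smult_closed(1)[OF c f]] tendsto_mult[OF tendsto_const conv[OF f]]]
        by simp
    }
  qed (use bound in auto)
  moreover have "\<xi> \<phi> = 0" if "\<phi> \<notin> carrier (dual K X)" for \<phi>
    using \<xi>B[of \<phi>] that by (simp add: B_def)
  ultimately have "\<xi> \<in> carrier (dual K (dual K X))"
    using bound(1) by (intro D.dual_carrierI[where C = 1]) auto
  moreover have "nrm (dual K (dual K X)) \<xi> \<le> 1"
    using bound(1) by (intro D.dual_nrm_le) auto
  ultimately show thesis
    using \<open>F \<noteq> bot\<close> \<open>F \<le> sequentially\<close> bound(1) conv by (intro that[of \<xi> F]) (auto simp: unit_ball_def)
qed

end

section \<open>Arens extensions as iterated evaluations\<close>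

locale normed_spaces_over = scalar_field +
  fixes N :: nat and X :: "nat \<Rightarrow> 'u normed_module"
  assumes normed_spaces: "i \<in> {1..N} \<Longrightarrow> normed_space K (X i)"
begin

lemma component: "i \<in> {1..N} \<Longrightarrow> normed_space_over K (X i)"
  by unfold_locales (rule normed_spaces)

lemma ball_tuples_subset: "x \<in> ball_tuples N X \<Longrightarrow> x \<in> tuples N X"
  by (auto simp: ball_tuples_def tuples_def unit_ball_def PiE_iff)

end

text \<open>The coordinates in \<open>I\<close> are free since pending limits will overwrite them.
  Extensionality is kept so that the tuples proper are the case \<open>I = {}\<close>, while the
  constant \<open>undefined\<close> tuple is the starting point for
  \<open>I = {1..N}\<close>.\<close>

definition partial_tuples :: "nat \<Rightarrow> (nat \<Rightarrow> 'u normed_module) \<Rightarrow> nat set \<Rightarrow> (nat \<Rightarrow> 'u) set" where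
  "partial_tuples N X I = {x \<in> extensional {1..N}. \<forall>i\<in>{1..N} - I. x i \<in> carrier (X i)}"

lemma partial_tuples_upd:
  "x \<in> partial_tuples N X (insert j I) \<Longrightarrow> j \<in> {1..N} \<Longrightarrow> u \<in> carrier (X j) \<Longrightarrow>
     x(j := u) \<in> partial_tuples N X I"
  "x \<in> partial_tuples N X I \<Longrightarrow> i \<in> {1..N} \<Longrightarrow> u \<in> carrier (X i) \<Longrightarrow>
     x(i := u) \<in> partial_tuples N X I"
  by (auto simp: partial_tuples_def extensional_def)

lemma partial_tuples_empty: "partial_tuples N X {} = tuples N X"
  by (auto simp: partial_tuples_def tuples_def PiE_def Pi_iff)

text \<open>The iterated limit, with the limit in the variable \<open>j\<close> replaced by the action of \<open>\<xi> j\<close>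
  on the functional that the inner limits leave in that variable.\<close>

primrec arens_value :: "(nat \<Rightarrow> 'u normed_module) \<Rightarrow> (nat \<Rightarrow> ('u \<Rightarrow> complex) \<Rightarrow> complex) \<Rightarrow>
    ((nat \<Rightarrow> 'u) \<Rightarrow> complex) \<Rightarrow> nat list \<Rightarrow> (nat \<Rightarrow> 'u) \<Rightarrow> complex" where
  "arens_value X \<xi> \<Phi> [] x = \<Phi> x"
| "arens_value X \<xi> \<Phi> (j # js) x =
     \<xi> j (\<lambda>u. if u \<in> carrier (X j) then arens_value X \<xi> \<Phi> js (x(j := u)) else 0)"

text \<open>Continuity is replaced by an explicit bound by the product of the norms, since this form
  of it passes through the successive limits. The sign of \<open>C\<close> is left open, hence
  \<open>\<bar>C\<bar>\<close> below.\<close>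

locale bounded_form = normed_spaces_over +
  fixes \<Phi> :: "(nat \<Rightarrow> 'u) \<Rightarrow> complex" and C :: real
  assumes form_linear: "x \<in> tuples N X \<Longrightarrow> i \<in> {1..N} \<Longrightarrow>
      linear_map K (X i) (scalars K) (\<lambda>u. \<Phi> (x(i := u)))"
    and form_bound: "x \<in> tuples N X \<Longrightarrow> cmod (\<Phi> x) \<le> C * (\<Prod>i\<in>{1..N}. nrm (X i) (x i))"

locale bidual_point = bounded_form +
  fixes \<xi> :: "nat \<Rightarrow> ('a \<Rightarrow> complex) \<Rightarrow> complex"
  assumes \<xi>_bidual: "i \<in> {1..N} \<Longrightarrow> \<xi> i \<in> carrier (dual K (dual K (X i)))"
    and \<xi>_bound: "i \<in> {1..N} \<Longrightarrow> \<phi> \<in> carrier (dual K (X i)) \<Longrightarrow> cmod (\<xi> i \<phi>) \<le> nrm (dual K (X i)) \<phi>"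
begin

text \<open>The argument of \<open>\<xi> j\<close> in \<open>arens_value\<close>, named so that it
  can be shown to lie in the dual; it vanishes off the carrier as elements of the dual do.\<close>

definition slice where
  "slice j js x = (\<lambda>u. if u \<in> carrier (X j) then arens_value X \<xi> \<Phi> js (x(j := u)) else 0)"

text \<open>\<open>lin\<close> and \<open>bd\<close> are the two induction hypotheses of
  \<open>arens_value_multilinear\<close> for \<open>js\<close>. Splitting the factor of
  \<open>j\<close> off the product bound leaves a bound for the slice as a functional.\<close>

lemma slice_in_dual:
  assumes j: "j \<in> {1..N}" "j \<notin> set js" and x: "x \<in> partial_tuples N X (set (j # js))"
    and lin: "\<And>x i. x \<in> partial_tuples N X (set js) \<Longrightarrow> i \<in> {1..N} - set js \<Longrightarrow>
        linear_map K (X i) (scalars K) (\<lambda>u. arens_value X \<xi> \<Phi> js (x(i := u)))"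
    and bd: "\<And>x. x \<in> partial_tuples N X (set js) \<Longrightarrow>
        cmod (arens_value X \<xi> \<Phi> js x) \<le> \<bar>C\<bar> * (\<Prod>i\<in>{1..N} - set js. nrm (X i) (x i))"
  shows "slice j js x \<in> carrier (dual K (X j))"
    and "nrm (dual K (X j)) (slice j js x) \<le> \<bar>C\<bar> * (\<Prod>i\<in>{1..N} - set (j # js). nrm (X i) (x i))"
proof -
  interpret Xj: normed_space_over K "X j" using j(1) by (rule component)
  let ?P = "\<bar>C\<bar> * (\<Prod>i\<in>{1..N} - set (j # js). nrm (X i) (x i))"
  have P: "0 \<le> ?P"
    using x normed_space_over.nrm_nonneg[OF component]
    by (intro mult_nonneg_nonneg prod_nonneg) (auto simp: partial_tuples_def)
  have bd': "cmod (slice j js x u) \<le> ?P * nrm (X j) u" if u: "u \<in> carrier (X j)" for u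
  proof -
    have "{1..N} - set js = insert j ({1..N} - set (j # js))" using j by auto
    then have "(\<Prod>i\<in>{1..N} - set js. nrm (X i) ((x(j := u)) i)) =
        (\<Prod>i\<in>insert j ({1..N} - set (j # js)). nrm (X i) ((x(j := u)) i))"
      by (rule arg_cong)
    also have "\<dots> = nrm (X j) u * (\<Prod>i\<in>{1..N} - set (j # js). nrm (X i) ((x(j := u)) i))"
      by (subst prod.insert) auto
    also have "(\<Prod>i\<in>{1..N} - set (j # js). nrm (X i) ((x(j := u)) i)) =
        (\<Prod>i\<in>{1..N} - set (j # js). nrm (X i) (x i))"
      by (rule prod.cong) auto
    finally show ?thesis
      using bd[of "x(j := u)"] u j x partial_tuples_upd(1)[of x N X j "set js" u]
      by (simp add: slice_def mult_ac)
  qed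
  \<comment> \<open>Coordinate \<open>j\<close> of \<open>x\<close> may lie outside
    \<open>X j\<close>, so \<open>lin\<close> applies only after some vector \<open>v\<close> has
    been put there; the update by \<open>u\<close> overwrites it.\<close>
  obtain v where v: "v \<in> carrier (X j)" using Xj.zero_closed by blast
  have "linear_map K (X j) (scalars K) (\<lambda>u. arens_value X \<xi> \<Phi> js ((x(j := v))(j := u)))"
    using j x v partial_tuples_upd(1)[of x N X j "set js" v] by (intro lin) auto
  then have "linear_map K (X j) (scalars K) (slice j js x)"
    by (simp add: linear_map_def slice_def Pi_iff)
  then show "slice j js x \<in> carrier (dual K (X j))"
    by (rule Xj.dual_carrierI[OF _ _ bd']) (auto simp: slice_def)
  show "nrm (dual K (X j)) (slice j js x) \<le> ?P"
    using P bd' by (rule Xj.dual_nrm_le)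
qed

text \<open>Linearity and the bound must be proved together: both are needed to see that a slice
  belongs to the dual, and only there is \<open>\<xi> j\<close> known to be linear and
  contractive.\<close>

lemma arens_value_multilinear:
  assumes "distinct js" "set js \<subseteq> {1..N}"
  shows "x \<in> partial_tuples N X (set js) \<Longrightarrow> i \<in> {1..N} - set js \<Longrightarrow>
        linear_map K (X i) (scalars K) (\<lambda>u. arens_value X \<xi> \<Phi> js (x(i := u)))"
    and "x \<in> partial_tuples N X (set js) \<Longrightarrow>
        cmod (arens_value X \<xi> \<Phi> js x) \<le> \<bar>C\<bar> * (\<Prod>i\<in>{1..N} - set js. nrm (X i) (x i))"
  using assms
proof (induction js arbitrary: x i)
  case Nil
  {
    case 1
    then show ?case
      unfolding arens_value.simps by (intro form_linear) (auto simp: partial_tuples_empty)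
  next
    case 2
    then have x: "x \<in> tuples N X" by (simp add: partial_tuples_empty)
    have "C * (\<Prod>i\<in>{1..N}. nrm (X i) (x i)) \<le> \<bar>C\<bar> * (\<Prod>i\<in>{1..N}. nrm (X i) (x i))"
      using x normed_space_over.nrm_nonneg[OF component]
      by (intro mult_right_mono prod_nonneg) (auto simp: tuples_def PiE_iff)
    then show ?case using form_bound[OF x] by simp
  }
next
  case (Cons j js)
  {
    case 1
    then have j: "j \<in> {1..N}" "j \<notin> set js" "distinct js" "set js \<subseteq> {1..N}"
      and i: "i \<in> {1..N}" "i \<noteq> j" "i \<notin> set js" by auto
    have D: "slice j js y \<in> carrier (dual K (X j))" if y: "y \<in> partial_tuples N X (set (j # js))" for y
      by (rule slice_in_dual(1)[OF j(1,2) y Cons.IH(1)[OF _ _ j(3,4)] Cons.IH(2)[OF _ j(3,4)]])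
    interpret Xi: normed_space_over K "X i" using i(1) by (rule component)
    interpret Xj: normed_space_over K "X j" using j(1) by (rule component)
    interpret Xj': normed_space_over K "dual K (X j)"
      by unfold_locales (rule Xj.normed_space_dual)
    note lin = linear_mapD[OF Xj'.dual_linear(1)[OF \<xi>_bidual[OF j(1)]]]
    have upd: "x(i := u) \<in> partial_tuples N X (set (j # js))" if "u \<in> carrier (X i)" for u
      using 1 that i by (intro partial_tuples_upd(2)) auto
    \<comment> \<open>The induction hypothesis updates \<open>j\<close> first; as
      \<open>i \<noteq> j\<close> the updates commute, so slices depend linearly on coordinate
      \<open>i\<close>, pointwise in \<open>v\<close>.\<close>
    have IH: "linear_map K (X i) (scalars K) (\<lambda>u. arens_value X \<xi> \<Phi> js (x(i := u, j := v)))"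
      if v: "v \<in> carrier (X j)" for v
    proof -
      have "x(j := v) \<in> partial_tuples N X (set js)"
        using 1 j v by (intro partial_tuples_upd(1)) auto
      then have "linear_map K (X i) (scalars K) (\<lambda>u. arens_value X \<xi> \<Phi> js (x(j := v, i := u)))"
        using Cons.IH(1)[of "x(j := v)" i] i j by blast
      then show ?thesis
        by (simp only: fun_upd_twist[OF i(2)])
    qed
    have "linear_map K (X i) (scalars K) (\<lambda>u. \<xi> j (slice j js (x(i := u))))"
      unfolding linear_map_def
    proof (intro conjI ballI Pi_I)
      fix u assume u: "u \<in> carrier (X i)"
      show "\<xi> j (slice j js (x(i := u))) \<in> carrier (scalars K)"
        using D[OF upd[OF u]] lin(1) by blast
      {
        fix w assume w: "w \<in> carrier (X i)"
        have "slice j js (x(i := u \<oplus>\<^bsub>X i\<^esub> w)) =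
            (\<lambda>v. slice j js (x(i := u)) v + slice j js (x(i := w)) v)"
        proof
          fix v
          show "slice j js (x(i := u \<oplus>\<^bsub>X i\<^esub> w)) v = slice j js (x(i := u)) v + slice j js (x(i := w)) v"
            using linear_mapD(2)[OF IH[of v] u w] by (cases "v \<in> carrier (X j)") (simp_all add: slice_def)
        qed
        then show "\<xi> j (slice j js (x(i := u \<oplus>\<^bsub>X i\<^esub> w))) =
            \<xi> j (slice j js (x(i := u))) \<oplus>\<^bsub>scalars K\<^esub> \<xi> j (slice j js (x(i := w)))"
          using lin(2)[OF D[OF upd[OF u]] D[OF upd[OF w]]] by simp
      next
        fix c assume c: "c \<in> K"
        have "slice j js (x(i := c \<odot>\<^bsub>X i\<^esub> u)) = (\<lambda>v. c * slice j js (x(i := u)) v)"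
        proof
          fix v
          show "slice j js (x(i := c \<odot>\<^bsub>X i\<^esub> u)) v = c * slice j js (x(i := u)) v"
            using linear_mapD(3)[OF IH[of v] c u] by (cases "v \<in> carrier (X j)") (simp_all add: slice_def)
        qed
        then show "\<xi> j (slice j js (x(i := c \<odot>\<^bsub>X i\<^esub> u))) =
            c \<odot>\<^bsub>scalars K\<^esub> \<xi> j (slice j js (x(i := u)))"
          using lin(3)[OF c D[OF upd[OF u]]] by simp
      }
    qed
    then show ?case by (simp only: slice_def arens_value.simps)
  next
    case 2
    then have j: "j \<in> {1..N}" "j \<notin> set js" "distinct js" "set js \<subseteq> {1..N}" by auto
    have D: "slice j js x \<in> carrier (dual K (X j))"
      by (rule slice_in_dual(1)[OF j(1,2) 2(1) Cons.IH(1)[OF _ _ j(3,4)] Cons.IH(2)[OF _ j(3,4)]])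
    have D2: "nrm (dual K (X j)) (slice j js x) \<le> \<bar>C\<bar> * (\<Prod>i\<in>{1..N} - set (j # js). nrm (X i) (x i))"
      by (rule slice_in_dual(2)[OF j(1,2) 2(1) Cons.IH(1)[OF _ _ j(3,4)] Cons.IH(2)[OF _ j(3,4)]])
    have "cmod (\<xi> j (slice j js x)) \<le> \<bar>C\<bar> * (\<Prod>i\<in>{1..N} - set (j # js). nrm (X i) (x i))"
      using \<xi>_bound[OF j(1) D] D2 by linarith
    then show ?case by (simp only: slice_def arens_value.simps)
  }
qed

lemma slice_dual:
  assumes "distinct (j # js)" "set (j # js) \<subseteq> {1..N}" "x \<in> partial_tuples N X (set (j # js))"
  shows "slice j js x \<in> carrier (dual K (X j))"
proof (rule slice_in_dual(1))
  show "linear_map K (X i) (scalars K) (\<lambda>u. arens_value X \<xi> \<Phi> js (y(i := u)))"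
    if "y \<in> partial_tuples N X (set js)" "i \<in> {1..N} - set js" for y i
    using that assms by (intro arens_value_multilinear(1)) auto
  show "cmod (arens_value X \<xi> \<Phi> js y) \<le> \<bar>C\<bar> * (\<Prod>i\<in>{1..N} - set js. nrm (X i) (y i))"
    if "y \<in> partial_tuples N X (set js)" for y
    using that assms by (intro arens_value_multilinear(2)) auto
qed (use assms in auto)

text \<open>By induction the inner limits leave a slice in the variable \<open>j\<close>. The slice
  is in the dual, so weak-star convergence of the net evaluates the outermost limit as
  \<open>\<xi> j\<close>.\<close>

lemma iterated_limit_eq:
  assumes "distinct js" "set js \<subseteq> {1..N}" "x \<in> partial_tuples N X (set js)"
    and "\<And>j. j \<in> set js \<Longrightarrow> bounded_wstar_net K (X j) (\<xi> j) (F j)"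
  shows "iterated_limit js F \<Phi> x = arens_value X \<xi> \<Phi> js x"
  using assms
proof (induction js arbitrary: x)
  case (Cons j js)
  then have net: "bounded_wstar_net K (X j) (\<xi> j) (F j)" by simp
  \<comment> \<open>The slice agrees with the inner limit only on the carrier, in which the net lies
    eventually.\<close>
  have "eventually (\<lambda>u. u \<in> carrier (X j)) (F j)"
    using net unfolding bounded_wstar_net_def by (auto elim: eventually_mono)
  then have "eventually (\<lambda>u. slice j js x u = iterated_limit js F \<Phi> (x(j := u))) (F j)"
  proof eventually_elim
    case (elim u)
    then have upd: "x(j := u) \<in> partial_tuples N X (set js)"
      using Cons.prems by (intro partial_tuples_upd(1)) auto
    have "iterated_limit js F \<Phi> (x(j := u)) = arens_value X \<xi> \<Phi> js (x(j := u))"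
      using Cons.prems by (intro Cons.IH upd) auto
    then show ?case using elim by (simp add: slice_def)
  qed
  moreover have "(slice j js x \<longlongrightarrow> \<xi> j (slice j js x)) (F j)"
    using net slice_dual[OF Cons.prems(1-3)] by (simp add: bounded_wstar_net_def)
  ultimately have "((\<lambda>u. iterated_limit js F \<Phi> (x(j := u))) \<longlongrightarrow> \<xi> j (slice j js x)) (F j)"
    using tendsto_cong by fastforce
  then show ?case
    using net by (simp add: tendsto_Lim bounded_wstar_net_def slice_def)
qed simp

text \<open>Every admissible choice of nets gives the same value. The existence of nets is assumed
  because otherwise the condition under \<open>THE\<close> would be vacuous and would not single out
  a number.\<close>

lemma arens_extension_eq:
  assumes "\<sigma> permutes {1..N}" and "\<And>j. j \<in> {1..N} \<Longrightarrow> \<exists>F. bounded_wstar_net K (X j) (\<xi> j) F"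
  shows "arens_extension K N X \<sigma> \<Phi> \<xi> =
    arens_value X \<xi> \<Phi> (map \<sigma> [1..<Suc N]) (\<lambda>_. undefined)"
proof -
  have set: "set (map \<sigma> [1..<Suc N]) = {1..N}"
    using permutes_image[OF assms(1)] by (simp add: atLeastLessThanSuc_atLeastAtMost del: upt_Suc)
  have dist: "distinct (map \<sigma> [1..<Suc N])"
    using permutes_inj_on[OF assms(1)] by (simp add: distinct_map del: upt_Suc)
  have init: "(\<lambda>_. undefined) \<in> partial_tuples N X {1..N}"
    by (simp add: partial_tuples_def extensional_def)
  have eq: "iterated_limit (map \<sigma> [1..<Suc N]) F \<Phi> (\<lambda>_. undefined) =
      arens_value X \<xi> \<Phi> (map \<sigma> [1..<Suc N]) (\<lambda>_. undefined)"
    if "\<forall>j\<in>{1..N}. bounded_wstar_net K (X j) (\<xi> j) (F j)" for F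
    by (rule iterated_limit_eq) (use that init dist set in \<open>auto simp del: upt_Suc\<close>)
  obtain F where "\<forall>j\<in>{1..N}. bounded_wstar_net K (X j) (\<xi> j) (F j)"
    using assms(2) by metis
  then show ?thesis
    unfolding arens_extension_def using eq by (intro the_equality) (auto simp del: upt_Suc)
qed

text \<open>Non-strict bounds on the modulus survive limits, so they pass through the evaluations
  one variable at a time. The coordinates outside \<open>js\<close> are already frozen at members of
  the sequence with index at least \<open>n\<close>, each with its own index.\<close>

lemma arens_value_limit_bounds:
  fixes F :: "nat \<Rightarrow> nat filter"
  assumes a: "\<And>m i. i \<in> {1..N} \<Longrightarrow> a m i \<in> carrier (X i)"
    and F: "\<And>i. i \<in> {1..N} \<Longrightarrow> F i \<noteq> bot" "\<And>i. i \<in> {1..N} \<Longrightarrow> F i \<le> sequentially"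
      "\<And>i \<phi>. i \<in> {1..N} \<Longrightarrow> \<phi> \<in> carrier (dual K (X i)) \<Longrightarrow> ((\<lambda>m. \<phi> (a m i)) \<longlongrightarrow> \<xi> i \<phi>) (F i)"
    and vals: "\<And>\<nu>. (\<And>i. i \<in> {1..N} \<Longrightarrow> n \<le> \<nu> i) \<Longrightarrow>
        l \<le> cmod (\<Phi> (\<lambda>i\<in>{1..N}. a (\<nu> i) i)) \<and> cmod (\<Phi> (\<lambda>i\<in>{1..N}. a (\<nu> i) i)) \<le> s"
    and js: "distinct js" "set js \<subseteq> {1..N}"
    and x: "x \<in> extensional {1..N}" "\<And>i. i \<in> {1..N} - set js \<Longrightarrow> \<exists>m\<ge>n. x i = a m i"
  shows "l \<le> cmod (arens_value X \<xi> \<Phi> js x) \<and> cmod (arens_value X \<xi> \<Phi> js x) \<le> s"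
  using js x
proof (induction js arbitrary: x)
  case Nil
  then obtain \<nu> where \<nu>: "\<And>i. i \<in> {1..N} \<Longrightarrow> n \<le> \<nu> i \<and> x i = a (\<nu> i) i"
    by (metis Diff_empty list.set(1))
  then have "x = (\<lambda>i\<in>{1..N}. a (\<nu> i) i)"
    using Nil.prems(3) by (auto simp: fun_eq_iff extensional_def)
  then show ?case
    unfolding arens_value.simps using vals[of \<nu>] \<nu> by blast
next
  case (Cons j js)
  then have j: "j \<in> {1..N}" by simp
  have "x \<in> partial_tuples N X (set (j # js))"
    using Cons.prems(3,4) a by (fastforce simp: partial_tuples_def)
  then have "((\<lambda>m. slice j js x (a m j)) \<longlongrightarrow> \<xi> j (slice j js x)) (F j)"
    using F(3)[OF j] slice_dual Cons.prems(1,2) by blast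
  then have lim: "((\<lambda>m. cmod (slice j js x (a m j))) \<longlongrightarrow> cmod (\<xi> j (slice j js x))) (F j)"
    by (rule tendsto_norm)
  \<comment> \<open>\<open>vals\<close> covers only indices from \<open>n\<close> on; since
    \<open>F j \<le> sequentially\<close>, the earlier ones do not affect the limit.\<close>
  have "eventually (\<lambda>m. m \<ge> n) (F j)"
    using F(2)[OF j] eventually_ge_at_top filter_leD by blast
  then have "eventually (\<lambda>m. l \<le> cmod (slice j js x (a m j)) \<and> cmod (slice j js x (a m j)) \<le> s) (F j)"
  proof eventually_elim
    case (elim m)
    have "l \<le> cmod (arens_value X \<xi> \<Phi> js (x(j := a m j))) \<and>
        cmod (arens_value X \<xi> \<Phi> js (x(j := a m j))) \<le> s"
      using Cons.prems elim by (intro Cons.IH) (auto simp: extensional_def)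
    then show ?case using a[OF j] by (simp add: slice_def)
  qed
  then have "l \<le> cmod (\<xi> j (slice j js x)) \<and> cmod (\<xi> j (slice j js x)) \<le> s"
    using tendsto_lowerbound[OF lim _ F(1)[OF j]] tendsto_upperbound[OF lim _ F(1)[OF j]]
    by (simp add: eventually_conj_iff)
  then show ?case by (simp add: slice_def)
qed

end

section \<open>From almost attaining sequences to attainment in the bidual\<close>

context bounded_form
begin

text \<open>In \<open>lb\<close> the indices of the coordinates are independent, so the estimate
  holds whatever the order of the limits. Hence cluster points chosen coordinate by coordinate serve
  all permutations at once.\<close>

lemma arens_extensions_attainI:
  assumes a: "\<And>m. a m \<in> ball_tuples N X" and \<rho>: "\<rho> \<longlonglongrightarrow> 0"
    and ub: "\<And>x. x \<in> ball_tuples N X \<Longrightarrow> cmod (\<Phi> x) \<le> sup_norm N X \<Phi>"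
    and lb: "\<And>n \<nu>. (\<And>i. i \<in> {1..N} \<Longrightarrow> n \<le> \<nu> i) \<Longrightarrow>
        sup_norm N X \<Phi> - \<rho> n \<le> cmod (\<Phi> (\<lambda>i\<in>{1..N}. a (\<nu> i) i))"
  shows "arens_extensions_attain K N X \<Phi>"
proof -
  have aball: "a m i \<in> unit_ball (X i)" if "i \<in> {1..N}" for m i
    using a[of m] that by (auto simp: ball_tuples_def PiE_iff)
  define P where "P i \<xi> F \<longleftrightarrow> \<xi> \<in> unit_ball (dual K (dual K (X i))) \<and> F \<noteq> bot \<and> F \<le> sequentially \<and>
      (\<forall>\<phi>\<in>carrier (dual K (X i)). cmod (\<xi> \<phi>) \<le> nrm (dual K (X i)) \<phi> \<and>
        ((\<lambda>n. \<phi> (a n i)) \<longlongrightarrow> \<xi> \<phi>) F)" for i \<xi> F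
  have "\<exists>\<xi> F. P i \<xi> F" if i: "i \<in> {1..N}" for i
    unfolding P_def
    by (rule normed_space_over.weak_star_cluster[OF component[OF i], of "\<lambda>n. a n i", OF aball[OF i]]) blast
  then obtain \<xi>' F where P: "\<And>i. i \<in> {1..N} \<Longrightarrow> P i (\<xi>' i) (F i)"
    by metis
  have \<xi>': "\<And>i. i \<in> {1..N} \<Longrightarrow> \<xi>' i \<in> unit_ball (dual K (dual K (X i)))"
    and F: "\<And>i. i \<in> {1..N} \<Longrightarrow> F i \<noteq> bot" "\<And>i. i \<in> {1..N} \<Longrightarrow> F i \<le> sequentially"
    and bd: "\<And>i \<phi>. i \<in> {1..N} \<Longrightarrow> \<phi> \<in> carrier (dual K (X i)) \<Longrightarrow>
        cmod (\<xi>' i \<phi>) \<le> nrm (dual K (X i)) \<phi>"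
    and lim: "\<And>i \<phi>. i \<in> {1..N} \<Longrightarrow> \<phi> \<in> carrier (dual K (X i)) \<Longrightarrow>
        ((\<lambda>n. \<phi> (a n i)) \<longlongrightarrow> \<xi>' i \<phi>) (F i)"
    using P by (auto simp: P_def)
  \<comment> \<open>The restriction is needed because members of \<open>ball_tuples\<close> are
    extensional.\<close>
  define \<xi> where "\<xi> = (\<lambda>i\<in>{1..N}. \<xi>' i)"
  have \<xi>eq: "\<xi> i = \<xi>' i" if "i \<in> {1..N}" for i
    using that by (simp add: \<xi>_def)
  have \<xi>_ball: "\<xi> \<in> ball_tuples N (\<lambda>i. dual K (dual K (X i)))"
    using \<xi>' by (auto simp: ball_tuples_def \<xi>_def)
  interpret bidual_point K N X \<Phi> C \<xi>
    using \<xi>' bd by unfold_locales (auto simp: \<xi>eq unit_ball_def)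
  \<comment> \<open>The images of the cluster filters are admissible nets, as
    \<open>arens_extension_eq\<close> requires.\<close>
  have net: "bounded_wstar_net K (X j) (\<xi> j) (filtermap (\<lambda>n. a n j) (F j))" if j: "j \<in> {1..N}" for j
    using F(1)[OF j] aball[OF j] lim[OF j]
    by (auto simp: bounded_wstar_net_def filtermap_bot_iff eventually_filtermap filterlim_filtermap
        \<xi>eq[OF j] unit_ball_def intro!: exI[of _ 1])
  have "cmod (arens_extension K N X \<sigma> \<Phi> \<xi>) = sup_norm N X \<Phi>" if \<sigma>: "\<sigma> permutes {1..N}" for \<sigma>
  proof -
    let ?v = "arens_value X \<xi> \<Phi> (map \<sigma> [1..<Suc N]) (\<lambda>_. undefined)"
    have set: "set (map \<sigma> [1..<Suc N]) = {1..N}"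
      using permutes_image[OF \<sigma>] by (simp add: atLeastLessThanSuc_atLeastAtMost del: upt_Suc)
    have dist: "distinct (map \<sigma> [1..<Suc N])"
      using permutes_inj_on[OF \<sigma>] by (simp add: distinct_map del: upt_Suc)
    have "sup_norm N X \<Phi> - \<rho> n \<le> cmod ?v \<and> cmod ?v \<le> sup_norm N X \<Phi>" for n
    proof (rule arens_value_limit_bounds[OF _ F, where a = a and n = n])
      show "((\<lambda>m. \<phi> (a m i)) \<longlongrightarrow> \<xi> i \<phi>) (F i)"
        if "i \<in> {1..N}" "\<phi> \<in> carrier (dual K (X i))" for i \<phi>
        using lim[OF that] \<xi>eq[OF that(1)] by simp
      show "sup_norm N X \<Phi> - \<rho> n \<le> cmod (\<Phi> (\<lambda>i\<in>{1..N}. a (\<nu> i) i)) \<and>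
          cmod (\<Phi> (\<lambda>i\<in>{1..N}. a (\<nu> i) i)) \<le> sup_norm N X \<Phi>"
        if "\<And>i. i \<in> {1..N} \<Longrightarrow> n \<le> \<nu> i" for \<nu>
        using lb[OF that] aball by (auto intro!: ub simp: ball_tuples_def)
    qed (use set dist aball in \<open>auto simp: unit_ball_def extensional_def simp del: upt_Suc\<close>)
    note bounds = this
    have "(\<lambda>n. sup_norm N X \<Phi> - \<rho> n) \<longlonglongrightarrow> sup_norm N X \<Phi>"
      using tendsto_diff[OF tendsto_const \<rho>, of "sup_norm N X \<Phi>"] by simp
    then have "sup_norm N X \<Phi> \<le> cmod ?v"
      by (rule LIMSEQ_le_const2) (use bounds in blast)
    with bounds have "cmod ?v = sup_norm N X \<Phi>"
      by (simp only: order.eq_iff)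
    then show ?thesis
      by (subst arens_extension_eq[OF \<sigma>]) (use net in blast)
  qed
  then show ?thesis
    unfolding arens_extensions_attain_def using \<xi>_ball by blast
qed

end

section \<open>Spaces in a Banach ideal\<close>

lemma ideal_space_simps [simp]:
  "carrier (ideal_space U nU X) = U X" "\<zero>\<^bsub>ideal_space U nU X\<^esub> = (\<lambda>p. 0)"
  "f \<oplus>\<^bsub>ideal_space U nU X\<^esub> g = (\<lambda>p. f p + g p)"
  "c \<odot>\<^bsub>ideal_space U nU X\<^esub> f = (\<lambda>p. c * f p)" "nrm (ideal_space U nU X) = nU X"
  by (simp_all add: ideal_space_def)

section \<open>The scalar field as a Banach space\<close>

lemma scalar_copy_simps [simp]:
  "carrier (scalar_copy K) = Inl ` K" "\<zero>\<^bsub>scalar_copy K\<^esub> = Inl 0"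
  "x \<oplus>\<^bsub>scalar_copy K\<^esub> y = Inl (projl x + projl y)"
  "c \<odot>\<^bsub>scalar_copy K\<^esub> x = Inl (c * projl x)" "nrm (scalar_copy K) x = cmod (projl x)"
  by (simp_all add: scalar_copy_def)

context scalar_field
begin

lemma normed_space_scalar_copy: "normed_space K (scalar_copy K)"
  unfolding normed_space_def
proof (intro conjI ballI)
  show "module (scalars K) (scalar_copy K)"
  proof (rule moduleI[OF cring_scalars])
    show "abelian_group (scalar_copy K)"
    proof (rule abelian_groupI)
      fix x assume "x \<in> carrier (scalar_copy K)"
      then show "\<exists>y\<in>carrier (scalar_copy K). y \<oplus>\<^bsub>scalar_copy K\<^esub> x = \<zero>\<^bsub>scalar_copy K\<^esub>"
        by (intro bexI[of _ "Inl (- projl x)"]) auto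
    qed (auto simp: algebra_simps)
  qed (auto simp: algebra_simps)
qed (auto simp: norm_mult norm_triangle_ineq)

sublocale scalar_copy: normed_space_over K "scalar_copy K :: (complex + 'a) normed_module"
  by unfold_locales (rule normed_space_scalar_copy)

lemma minus_scalar_copy:
  "x \<in> K \<Longrightarrow> y \<in> K \<Longrightarrow> Inl x \<ominus>\<^bsub>scalar_copy K\<^esub> Inl y = (Inl (x - y) :: complex + 'a)"
  using scalar_copy.smult_minus_one[of "Inl y :: complex + 'a", symmetric] by (simp add: a_minus_def)

text \<open>Makes the tuple of scalar fields an admissible domain in the composition axiom of the
  ideal. Completeness comes from the complex numbers because \<open>K\<close> is closed.\<close>

lemma banach_space_scalar_copy: "banach_space K (scalar_copy K :: (complex + 'a) normed_module)"
  unfolding banach_space_def scalar_copy.metric.mcomplete_def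
proof (intro conjI allI impI normed_space_scalar_copy)
  let ?S = "scalar_copy K :: (complex + 'a) normed_module"
  fix \<sigma> :: "nat \<Rightarrow> complex + 'a" assume \<sigma>: "scalar_copy.metric.MCauchy \<sigma>"
  define z where "z = projl \<circ> \<sigma>"
  have z: "\<sigma> n = Inl (z n)" "z n \<in> K" for n
  proof -
    have "\<sigma> n \<in> Inl ` K"
      using \<sigma> unfolding scalar_copy.metric.MCauchy_def by auto
    then show "\<sigma> n = Inl (z n)" "z n \<in> K" by (auto simp: z_def)
  qed
  have dist: "ndist ?S (Inl x) (Inl y) = dist x y" if "x \<in> K" "y \<in> K" for x y
    using that by (simp add: ndist_def minus_scalar_copy dist_norm)
  have "Cauchy z"
    using \<sigma> unfolding scalar_copy.metric.MCauchy_def Cauchy_def by (simp add: z dist)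
  then obtain l where l: "z \<longlonglongrightarrow> l"
    by (auto simp: Cauchy_convergent_iff convergent_def)
  then have "l \<in> K"
    using closed_scalars z(2) by (metis closed_sequentially)
  then have "limitin scalar_copy.metric.mtopology \<sigma> (Inl l) sequentially"
    using l unfolding scalar_copy.metric.limitin_metric by (simp add: z dist tendsto_iff)
  then show "\<exists>x. limitin scalar_copy.metric.mtopology \<sigma> x sequentially" by blast
qed

end

section \<open>The ideal at a fixed tuple of Banach spaces\<close>

locale banach_ideal_at = scalar_field +
  fixes N :: nat
    and U :: "(nat \<Rightarrow> (complex + 'a) normed_module) \<Rightarrow> ((nat \<Rightarrow> complex + 'a) \<Rightarrow> complex) set"
    and nU :: "(nat \<Rightarrow> (complex + 'a) normed_module) \<Rightarrow> ((nat \<Rightarrow> complex + 'a) \<Rightarrow> complex) \<Rightarrow> real"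
    and X :: "nat \<Rightarrow> (complex + 'a) normed_module"
  assumes N: "1 \<le> N" and ideal: "banach_ideal K N U nU"
    and banach: "\<forall>i\<in>{1..N}. banach_space K (X i)"
begin

sublocale normed_spaces_over K N X
  using banach by unfold_locales (auto simp: banach_space_def)

lemma ideal_normed_space: "(\<forall>i\<in>{1..N}. banach_space K (Z i)) \<Longrightarrow> normed_space K (ideal_space U nU Z)"
  using ideal unfolding banach_ideal_def normed_ideal_def by blast

sublocale U: normed_space_over K "ideal_space U nU X"
  using ideal_normed_space[OF banach] by unfold_locales

lemma U_forms: "U X \<subseteq> forms K N X"
proof -
  have "submodule (U X) (scalars K) (form_space K N X)"
    using ideal banach unfolding banach_ideal_def normed_ideal_def by blast
  then have "subgroup (U X) (add_monoid (form_space K N X))"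
    by (rule submodule.axioms(1))
  from subgroup.subset[OF this] show ?thesis
    by (simp add: form_space_def)
qed

lemma U_linear:
  "\<Phi> \<in> U X \<Longrightarrow> x \<in> tuples N X \<Longrightarrow> i \<in> {1..N} \<Longrightarrow> linear_map K (X i) (scalars K) (\<lambda>u. \<Phi> (x(i := u)))"
  using U_forms by (auto simp: forms_def)

lemma U_outside: "\<Phi> \<in> U X \<Longrightarrow> x \<notin> tuples N X \<Longrightarrow> \<Phi> x = 0"
  using U_forms by (auto simp: forms_def)

lemma U_scalar: "\<Phi> \<in> U X \<Longrightarrow> \<Phi> x \<in> K"
proof (cases "x \<in> tuples N X")
  case True
  assume \<Phi>: "\<Phi> \<in> U X"
  \<comment> \<open>Values lie in \<open>K\<close> because the form is linear in some variable; this
    is where \<open>1 \<le> N\<close> enters.\<close>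
  have one: "(1::nat) \<in> {1..N}" using N by simp
  then have "x 1 \<in> carrier (X 1)" using True by (simp add: tuples_def PiE_iff)
  from linear_mapD(1)[OF U_linear[OF \<Phi> True one] this] show ?thesis by simp
qed (simp add: U_outside)

text \<open>Scalars are pulled out one coordinate at a time, by induction on the set
  \<open>I\<close> of coordinates already scaled.\<close>

lemma U_homogeneous:
  assumes \<Phi>: "\<Phi> \<in> U X" and x: "x \<in> tuples N X" and c: "\<And>i. i \<in> {1..N} \<Longrightarrow> c i \<in> K"
    and I: "finite I" "I \<subseteq> {1..N}"
  shows "\<Phi> (\<lambda>i. if i \<in> I then c i \<odot>\<^bsub>X i\<^esub> x i else x i) = (\<Prod>i\<in>I. c i) * \<Phi> x"
  using I
proof induction
  case (insert j I)
  let ?y = "\<lambda>i. if i \<in> I then c i \<odot>\<^bsub>X i\<^esub> x i else x i"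
  have sm: "c i \<odot>\<^bsub>X i\<^esub> x i \<in> carrier (X i)" if "i \<in> {1..N}" for i
    using x that by (intro normed_space_over.smult_carrier[OF component[OF that] c[OF that]])
      (auto simp: tuples_def PiE_iff)
  have y: "?y \<in> tuples N X"
    using insert.prems x sm by (auto simp: tuples_def PiE_iff extensional_def)
  have j: "j \<in> {1..N}" "?y j = x j" "x j \<in> carrier (X j)"
    using insert x by (auto simp: tuples_def PiE_iff)
  have "(\<lambda>i. if i \<in> insert j I then c i \<odot>\<^bsub>X i\<^esub> x i else x i) = ?y(j := c j \<odot>\<^bsub>X j\<^esub> x j)"
    using insert by auto
  then have "\<Phi> (\<lambda>i. if i \<in> insert j I then c i \<odot>\<^bsub>X i\<^esub> x i else x i) =
      \<Phi> (?y(j := c j \<odot>\<^bsub>X j\<^esub> x j))"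
    by (rule arg_cong)
  also have "\<dots> = c j * \<Phi> (?y(j := x j))"
    using linear_mapD(3)[OF U_linear[OF \<Phi> y j(1)] c[OF j(1)] j(3)] by (simp only: scalars_simps)
  also have "?y(j := x j) = ?y"
    using j(2) by (rule fun_upd_idem)
  finally show ?case
    using insert by simp
qed simp

text \<open>Composing \<open>\<Phi>\<close> with the operators \<open>c \<mapsto> c x\<^sub>i\<close> gives \<open>\<Phi> x\<close> times the product form, whose
  norm is \<open>1\<close>.\<close>

lemma U_bound:
  assumes \<Phi>: "\<Phi> \<in> U X" and x: "x \<in> tuples N X"
  shows "cmod (\<Phi> x) \<le> nU X \<Phi> * (\<Prod>i\<in>{1..N}. nrm (X i) (x i))"
proof -
  let ?S = "scalar_copy K :: (complex + 'a) normed_module"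
  define T where "T i s = projl s \<odot>\<^bsub>X i\<^esub> x i" for i and s :: "complex + 'a"
  have xi: "x i \<in> carrier (X i)" if "i \<in> {1..N}" for i
    using x that by (auto simp: tuples_def)
  have Tn: "nrm (X i) (T i s) = nrm (X i) (x i) * nrm ?S s"
    if i: "i \<in> {1..N}" and s: "s \<in> carrier ?S" for i s
  proof -
    interpret Xi: normed_space_over K "X i" using i by (rule component)
    show ?thesis using s xi[OF i] by (auto simp: T_def Xi.nrm_smult)
  qed
  have T: "bounded_operator K ?S (X i) (T i)" if i: "i \<in> {1..N}" for i
  proof -
    interpret Xi: normed_space_over K "X i" using i by (rule component)
    show ?thesis
      unfolding bounded_operator_def linear_map_def
      using xi[OF i] Xi.smult_l_distr Xi.smult_assoc1 Tn[OF i]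
      by (auto simp: T_def intro!: exI[of _ "nrm (X i) (x i)"])
  qed
  have Tnorm: "operator_norm ?S (X i) (T i) \<le> nrm (X i) (x i)" if i: "i \<in> {1..N}" for i
    using Tn[OF i] normed_space_over.nrm_nonneg[OF component[OF i] xi[OF i]]
    by (intro scalar_copy.operator_norm_le) auto
  \<comment> \<open>Products are compared factor by factor below, which needs nonnegative factors;
    the value at zero bounds the supremum from below.\<close>
  have Tnorm0: "0 \<le> operator_norm ?S (X i) (T i)" if i: "i \<in> {1..N}" for i
  proof -
    have nn: "0 \<le> nrm (X i) (x i)"
      by (rule normed_space_over.nrm_nonneg[OF component[OF i] xi[OF i]])
    have "nrm (X i) (T i \<zero>\<^bsub>?S\<^esub>) \<le> operator_norm ?S (X i) (T i)"
      unfolding operator_norm_def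
    proof (rule cSUP_upper)
      show "bdd_above ((\<lambda>s. nrm (X i) (T i s)) ` unit_ball ?S)"
        using Tn[OF i] mult_left_mono[OF _ nn]
        by (intro bdd_aboveI2[of _ _ "nrm (X i) (x i)"]) (fastforce simp: unit_ball_def)
    qed (rule scalar_copy.zero_in_unit_ball)
    then show ?thesis
      using Tn[OF i, of "\<zero>\<^bsub>?S\<^esub>"] by simp
  qed
  have eq: "compose_form N (\<lambda>_. ?S) \<Phi> T = (\<lambda>p. \<Phi> x * product_form K N p)"
  proof
    fix p :: "nat \<Rightarrow> complex + 'a"
    show "compose_form N (\<lambda>_. ?S) \<Phi> T p = \<Phi> x * product_form K N p"
    proof (cases "p \<in> tuples N (\<lambda>_. ?S)")
      case True
      \<comment> \<open>Off \<open>{1..N}\<close> both sides are \<open>undefined\<close>, as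
        \<open>x\<close> is extensional; the right-hand side has the shape that
        \<open>U_homogeneous\<close> expects.\<close>
      have "(\<lambda>i\<in>{1..N}. T i (p i)) = (\<lambda>i. if i \<in> {1..N} then projl (p i) \<odot>\<^bsub>X i\<^esub> x i else x i)"
        using x by (auto simp: T_def tuples_def PiE_def extensional_def)
      moreover have "projl (p i) \<in> K" if "i \<in> {1..N}" for i
      proof -
        have "p i \<in> Inl ` K" using True that by (simp add: tuples_def PiE_iff)
        then show ?thesis by auto
      qed
      ultimately show ?thesis
        using True U_homogeneous[OF \<Phi> x, of "\<lambda>i. projl (p i)" "{1..N}"]
        by (simp add: compose_form_def product_form_def)
    qed (simp add: compose_form_def product_form_def)
  qed
  have S: "\<forall>i\<in>{1..N}. banach_space K ?S"
    using banach_space_scalar_copy by blast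
  interpret US: normed_space_over K "ideal_space U nU (\<lambda>_. ?S)"
    using ideal_normed_space[OF S] by unfold_locales
  have "product_form K N \<in> U (\<lambda>_. ?S)" "nU (\<lambda>_. ?S) (product_form K N) = 1"
    using ideal by (simp_all add: banach_ideal_def normed_ideal_def)
  then have "cmod (\<Phi> x) = nU (\<lambda>_. ?S) (compose_form N (\<lambda>_. ?S) \<Phi> T)"
    using US.nrm_smult[OF U_scalar[OF \<Phi>, of x], of "product_form K N"] by (simp add: eq)
  also have "\<dots> \<le> nU X \<Phi> * (\<Prod>i\<in>{1..N}. operator_norm ?S (X i) (T i))"
  proof -
    have "\<forall>X Z T \<Phi>.
        (\<forall>i\<in>{1..N}. banach_space K (X i)) \<and> (\<forall>i\<in>{1..N}. banach_space K (Z i)) \<and>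
        (\<forall>i\<in>{1..N}. bounded_operator K (Z i) (X i) (T i)) \<and> \<Phi> \<in> U X \<longrightarrow>
        nU Z (compose_form N Z \<Phi> T) \<le> nU X \<Phi> * (\<Prod>i\<in>{1..N}. operator_norm (Z i) (X i) (T i))"
      using ideal unfolding banach_ideal_def normed_ideal_def by blast
    from this[rule_format, of X "\<lambda>_. ?S" T \<Phi>] show ?thesis
      using banach S T \<Phi> by auto
  qed
  also have "\<dots> \<le> nU X \<Phi> * (\<Prod>i\<in>{1..N}. nrm (X i) (x i))"
    using Tnorm Tnorm0 U.nrm_nonneg[of \<Phi>] \<Phi> by (intro mult_left_mono prod_mono) auto
  finally show ?thesis .
qed

lemma U_bounded_form: "\<Phi> \<in> U X \<Longrightarrow> bounded_form K N X \<Phi> (nU X \<Phi>)"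
  by unfold_locales (rule U_linear U_bound; assumption)+

lemma ball_prod_le:
  assumes "x \<in> ball_tuples N X"
  shows "(\<Prod>i\<in>{1..N}. nrm (X i) (x i)) \<le> 1"
proof (rule prod_le_1)
  fix i assume i: "i \<in> {1..N}"
  then show "0 \<le> nrm (X i) (x i) \<and> nrm (X i) (x i) \<le> 1"
    using assms normed_space_over.nrm_nonneg[OF component[OF i]]
    by (auto simp: ball_tuples_def unit_ball_def PiE_iff)
qed

text \<open>The product of norms in \<open>U_bound\<close> is at most 1 on the ball. Through this,
  ideal distances control values and supremum norms in the iteration.\<close>

lemma U_le: "\<Phi> \<in> U X \<Longrightarrow> x \<in> ball_tuples N X \<Longrightarrow> cmod (\<Phi> x) \<le> nU X \<Phi>"
  using U_bound[of \<Phi> x] ball_tuples_subset[of x] ball_prod_le[of x] U.nrm_nonneg[of \<Phi>]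
    mult_left_mono[of "\<Prod>i\<in>{1..N}. nrm (X i) (x i)" 1 "nU X \<Phi>"] by simp

lemma zero_tuple_in_ball: "(\<lambda>i\<in>{1..N}. \<zero>\<^bsub>X i\<^esub>) \<in> ball_tuples N X"
  using normed_space_over.zero_in_unit_ball[OF component] by (auto simp: ball_tuples_def)

lemma le_sup_norm: "\<Phi> \<in> U X \<Longrightarrow> x \<in> ball_tuples N X \<Longrightarrow> cmod (\<Phi> x) \<le> sup_norm N X \<Phi>"
  unfolding sup_norm_def
  by (intro cSUP_upper bdd_aboveI2[of _ _ "nU X \<Phi>"]) (auto intro: U_le)

lemma sup_norm_le: "(\<And>x. x \<in> ball_tuples N X \<Longrightarrow> cmod (\<Phi> x) \<le> s) \<Longrightarrow> sup_norm N X \<Phi> \<le> s"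
  unfolding sup_norm_def using zero_tuple_in_ball by (intro cSUP_least) auto

lemma sup_norm_approx:
  assumes "e > 0"
  obtains x where "x \<in> ball_tuples N X" "sup_norm N X \<Phi> - e < cmod (\<Phi> x)"
proof -
  have "\<exists>x\<in>ball_tuples N X. sup_norm N X \<Phi> - e < cmod (\<Phi> x)"
  proof (rule ccontr)
    assume "\<not> ?thesis"
    then have "sup_norm N X \<Phi> \<le> sup_norm N X \<Phi> - e" by (intro sup_norm_le) force
    with assms show False by simp
  qed
  then show thesis using that by blast
qed

lemma U_add: "\<Phi> \<in> U X \<Longrightarrow> \<Psi> \<in> U X \<Longrightarrow> (\<lambda>x. \<Phi> x + \<Psi> x) \<in> U X"
  and U_smult: "c \<in> K \<Longrightarrow> \<Phi> \<in> U X \<Longrightarrow> (\<lambda>x. c * \<Phi> x) \<in> U X"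
  and U_zero: "(\<lambda>x. 0) \<in> U X"
  and nU_triangle: "\<Phi> \<in> U X \<Longrightarrow> \<Psi> \<in> U X \<Longrightarrow> nU X (\<lambda>x. \<Phi> x + \<Psi> x) \<le> nU X \<Phi> + nU X \<Psi>"
  and nU_smult: "c \<in> K \<Longrightarrow> \<Phi> \<in> U X \<Longrightarrow> nU X (\<lambda>x. c * \<Phi> x) = cmod c * nU X \<Phi>"
  and nU_nonneg: "\<Phi> \<in> U X \<Longrightarrow> 0 \<le> nU X \<Phi>"
  and nU_zero: "nU X (\<lambda>x. 0) = 0"
  using U.a_closed[of \<Phi> \<Psi>] U.smult_carrier[of c \<Phi>] U.zero_closed U.nrm_triangle[of \<Phi> \<Psi>]
    U.nrm_smult[of c \<Phi>] U.nrm_nonneg[of \<Phi>] U.nrm_zero by simp_all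

lemma U_minus:
  assumes "\<Phi> \<in> U X" "\<Psi> \<in> U X"
  shows U_diff: "(\<lambda>x. \<Phi> x - \<Psi> x) \<in> U X"
    and ndist_U: "ndist (ideal_space U nU X) \<Phi> \<Psi> = nU X (\<lambda>x. \<Phi> x - \<Psi> x)"
proof -
  have "\<Phi> \<ominus>\<^bsub>ideal_space U nU X\<^esub> \<Psi> = (\<lambda>x. \<Phi> x - \<Psi> x)"
    using U.smult_minus_one[of \<Psi>, symmetric] assms by (simp add: a_minus_def)
  then show "(\<lambda>x. \<Phi> x - \<Psi> x) \<in> U X" "ndist (ideal_space U nU X) \<Phi> \<Psi> = nU X (\<lambda>x. \<Phi> x - \<Psi> x)"
    using U.minus_closed[of \<Phi> \<Psi>] assms by (simp_all add: ndist_def)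
qed

lemma U_complete:
  assumes f: "\<And>n. f n \<in> U X"
    and C: "\<And>e. e > 0 \<Longrightarrow> \<exists>M. \<forall>m\<ge>M. \<forall>n\<ge>M. nU X (\<lambda>x. f m x - f n x) < e"
  obtains g where "g \<in> U X" "(\<lambda>n. nU X (\<lambda>x. f n x - g x)) \<longlonglongrightarrow> 0"
proof -
  have "U.metric.mcomplete"
    using ideal banach unfolding banach_ideal_def banach_space_def by blast
  moreover have "U.metric.MCauchy f"
    unfolding U.metric.MCauchy_def using f C by (auto simp: ndist_U)
  ultimately obtain g where g: "limitin U.metric.mtopology f g sequentially"
    unfolding U.metric.mcomplete_def by blast
  then have "g \<in> U X" "(\<lambda>n. ndist (ideal_space U nU X) (f n) g) \<longlonglongrightarrow> 0"
    unfolding U.metric.limitin_metric_dist_null by auto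
  then show thesis
    using that f by (simp add: ndist_U)
qed

lemma closure_eq_UI:
  assumes "S \<subseteq> U X" "\<And>\<Phi> e. \<Phi> \<in> U X \<Longrightarrow> e > 0 \<Longrightarrow> \<exists>\<Psi>\<in>S. nU X (\<lambda>x. \<Phi> x - \<Psi> x) < e"
  shows "norm_topology (ideal_space U nU X) closure_of S = U X"
  unfolding norm_topology_def U.metric.metric_closure_of
proof (intro antisym subsetI)
  fix \<Phi> assume "\<Phi> \<in> U X"
  then have "\<exists>\<Psi>\<in>S. \<Psi> \<in> U.metric.mball \<Phi> r" if "r > 0" for r
    using assms(2)[of \<Phi> r] assms(1) that
    by (metis U.metric.in_mball ideal_space_simps(1) ndist_U subsetD)
  then show "\<Phi> \<in> {\<Phi> \<in> carrier (ideal_space U nU X). \<forall>r>0. \<exists>\<Psi>\<in>S. \<Psi> \<in> U.metric.mball \<Phi> r}"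
    using \<open>\<Phi> \<in> U X\<close> by simp
qed simp

end

section \<open>The Lindenstrauss iteration\<close>

lemma ball_tuples_mem: "x \<in> ball_tuples N X \<Longrightarrow> i \<in> {1..N} \<Longrightarrow> x i \<in> unit_ball (X i)"
  by (auto simp: ball_tuples_def PiE_iff)

text \<open>The tuple \<open>P_J(x) + P_{J^c}(y)\<close>, written coordinatewise without
  addition.\<close>

definition mix :: "nat \<Rightarrow> nat set \<Rightarrow> (nat \<Rightarrow> 'u) \<Rightarrow> (nat \<Rightarrow> 'u) \<Rightarrow> nat \<Rightarrow> 'u" where
  "mix N J x y = (\<lambda>k\<in>{1..N}. if k \<in> J then x k else y k)"

lemma mix_same: "x \<in> extensional {1..N} \<Longrightarrow> mix N J x x = x"
  by (auto simp: mix_def extensional_def)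

lemma mix_ball: "x \<in> ball_tuples N X \<Longrightarrow> y \<in> ball_tuples N X \<Longrightarrow> mix N J x y \<in> ball_tuples N X"
  by (auto simp: mix_def ball_tuples_def PiE_iff)

definition V_sum :: "nat \<Rightarrow> (nat \<Rightarrow> 'u normed_module) \<Rightarrow> (nat \<Rightarrow> 'u) \<Rightarrow>
    ((nat \<Rightarrow> 'u) \<Rightarrow> complex) \<Rightarrow> (nat \<Rightarrow> 'u) \<Rightarrow> complex" where
  "V_sum N X a \<Phi> = (\<lambda>x. \<Sum>J\<in>Pow {1..N}. V_form N X J a \<Phi> x)"

lemma (in normed_spaces_over) V_form_eq:
  assumes "a \<in> tuples N X" "x \<in> tuples N X"
  shows "V_form N X J a \<Phi> x = \<Phi> (mix N J x a) * \<Phi> (mix N J a x)"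
proof -
  have "tuple_add N X (proj N X J x) (proj N X ({1..N} - J) y) = mix N J x y"
    if "x \<in> tuples N X" "y \<in> tuples N X" for x y
  proof
    fix k
    show "tuple_add N X (proj N X J x) (proj N X ({1..N} - J) y) k = mix N J x y k"
    proof (cases "k \<in> {1..N}")
      case True
      interpret Xk: normed_space_over K "X k" using True by (rule component)
      have "x k \<in> carrier (X k)" "y k \<in> carrier (X k)"
        using that True by (simp_all add: tuples_def PiE_iff)
      then show ?thesis using True by (simp add: tuple_add_def proj_def mix_def)
    next
      case False
      then show ?thesis by (simp only: tuple_add_def mix_def restrict_def if_False)
    qed
  qed
  then show ?thesis using assms by (simp add: V_form_def)
qed

section \<open>Ideal distances, the perturbation and its estimates\<close>

locale stable_ideal_at = banach_ideal_at +
  assumes stable: "stable_at N U nU X"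
begin

definition dU where "dU \<Phi> \<Psi> = nU X (\<lambda>x. \<Phi> x - \<Psi> x)"

lemma dU_eq_ndist: "\<Phi> \<in> U X \<Longrightarrow> \<Psi> \<in> U X \<Longrightarrow> dU \<Phi> \<Psi> = ndist (ideal_space U nU X) \<Phi> \<Psi>"
  by (simp add: dU_def ndist_U)

lemma dU_commute: "\<Phi> \<in> U X \<Longrightarrow> \<Psi> \<in> U X \<Longrightarrow> dU \<Phi> \<Psi> = dU \<Psi> \<Phi>"
  by (simp add: dU_eq_ndist U.metric.commute)

lemma dU_triangle: "\<Phi> \<in> U X \<Longrightarrow> \<Psi> \<in> U X \<Longrightarrow> \<Theta> \<in> U X \<Longrightarrow> dU \<Phi> \<Theta> \<le> dU \<Phi> \<Psi> + dU \<Psi> \<Theta>"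
  using U.metric.triangle[of \<Phi> \<Psi> \<Theta>] by (simp add: dU_eq_ndist)

lemma nU_le_dU: "\<Phi> \<in> U X \<Longrightarrow> \<Psi> \<in> U X \<Longrightarrow> nU X \<Phi> \<le> nU X \<Psi> + dU \<Psi> \<Phi>"
  using nU_triangle[OF _ U_diff, of \<Psi> \<Phi> \<Psi>] dU_commute[of \<Phi> \<Psi>] by (simp add: dU_def)

lemma value_dU:
  assumes "\<Phi> \<in> U X" "\<Psi> \<in> U X" "x \<in> ball_tuples N X"
  shows "cmod (\<Phi> x) \<le> cmod (\<Psi> x) + dU \<Phi> \<Psi>"
  using U_le[OF U_diff[OF assms(1,2)] assms(3)] norm_triangle_sub[of "\<Phi> x" "\<Psi> x"]
  by (simp add: dU_def)

lemma sup_norm_dU: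
  assumes "\<Phi> \<in> U X" "\<Psi> \<in> U X"
  shows "sup_norm N X \<Phi> \<le> sup_norm N X \<Psi> + dU \<Phi> \<Psi>"
  using value_dU[OF assms] le_sup_norm[OF assms(2)] by (intro sup_norm_le) force

lemma sup_norm_le_nU: "\<Phi> \<in> U X \<Longrightarrow> sup_norm N X \<Phi> \<le> nU X \<Phi>"
  by (intro sup_norm_le U_le)

lemma U_sum:
  fixes b :: real
  assumes "finite A" "\<And>j. j \<in> A \<Longrightarrow> f j \<in> U X \<and> nU X (f j) \<le> b"
  shows "(\<lambda>x. \<Sum>j\<in>A. f j x) \<in> U X \<and> nU X (\<lambda>x. \<Sum>j\<in>A. f j x) \<le> card A * b"
  using assms
proof (induction A)
  case (insert j A)
  then have IH: "(\<lambda>x. \<Sum>j\<in>A. f j x) \<in> U X" "nU X (\<lambda>x. \<Sum>j\<in>A. f j x) \<le> card A * b"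
    and j: "f j \<in> U X" "nU X (f j) \<le> b" by auto
  show ?case
    using insert.hyps U_add[OF j(1) IH(1)] add_mono[OF j(2) IH(2)]
      order_trans[OF nU_triangle[OF j(1) IH(1)]] by (simp add: distrib_right)
qed (simp add: U_zero nU_zero)

lemma V_sum_stable:
  obtains M where "M > 0" "\<And>a \<Phi>. a \<in> ball_tuples N X \<Longrightarrow> \<Phi> \<in> U X \<Longrightarrow>
    V_sum N X a \<Phi> \<in> U X \<and> nU X (V_sum N X a \<Phi>) \<le> M * (nU X \<Phi>)\<^sup>2"
proof -
  obtain C where C: "C > 0" "\<And>a J \<Phi>. a \<in> tuples N X \<Longrightarrow> J \<subseteq> {1..N} \<Longrightarrow> \<Phi> \<in> U X \<Longrightarrow>
      V_form N X J a \<Phi> \<in> U X \<and>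
      nU X (V_form N X J a \<Phi>) \<le> C * (nU X \<Phi>)\<^sup>2 * (\<Prod>i\<in>{1..N}. nrm (X i) (a i))"
    using stable unfolding stable_at_def by blast
  show thesis
  proof
    \<comment> \<open>One stability constant for each of the \<open>2 ^ N\<close> subsets; the
      product of the norms of \<open>a\<close> is at most 1.\<close>
    show "2 ^ N * C > 0" using C(1) by simp
    fix a \<Phi> assume a: "a \<in> ball_tuples N X" and \<Phi>: "\<Phi> \<in> U X"
    have "C * (nU X \<Phi>)\<^sup>2 * (\<Prod>i\<in>{1..N}. nrm (X i) (a i)) \<le> C * (nU X \<Phi>)\<^sup>2"
      using mult_left_mono[OF ball_prod_le[OF a], of "C * (nU X \<Phi>)\<^sup>2"] C(1) by simp
    then have "V_form N X J a \<Phi> \<in> U X \<and> nU X (V_form N X J a \<Phi>) \<le> C * (nU X \<Phi>)\<^sup>2"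
      if "J \<in> Pow {1..N}" for J
      using C(2)[OF ball_tuples_subset[OF a] _ \<Phi>, of J] that by force
    from U_sum[of "Pow {1..N}" "\<lambda>J. V_form N X J a \<Phi>", OF _ this] show "V_sum N X a \<Phi> \<in> U X \<and>
        nU X (V_sum N X a \<Phi>) \<le> (2 ^ N * C) * (nU X \<Phi>)\<^sup>2"
      by (simp add: V_sum_def card_Pow algebra_simps)
  qed
qed

lemma V_sum_diag:
  assumes "a \<in> ball_tuples N X"
  shows "V_sum N X a \<Phi> a = 2 ^ N * (\<Phi> a)\<^sup>2"
proof -
  have "a \<in> tuples N X" "a \<in> extensional {1..N}"
    using assms ball_tuples_subset by (auto simp: tuples_def PiE_def)
  then show ?thesis
    by (simp add: V_sum_def V_form_eq mix_same card_Pow power2_eq_square)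
qed

text \<open>For the chosen \<open>J\<close> the factor at \<open>mix N J a x\<close> is kept; every
  other factor in the sum is estimated by \<open>s\<close>. Thus a deficit of that single factor
  remains visible in the whole sum.\<close>

lemma V_sum_bound:
  assumes \<Phi>: "\<Phi> \<in> U X" and a: "a \<in> ball_tuples N X" and x: "x \<in> ball_tuples N X"
    and J: "J \<subseteq> {1..N}" and s: "s = sup_norm N X \<Phi>"
  shows "cmod (V_sum N X a \<Phi> x) \<le> (2 ^ N - 1) * s\<^sup>2 + s * cmod (\<Phi> (mix N J a x))"
proof -
  have le: "cmod (\<Phi> (mix N I y z)) \<le> s" if "y \<in> ball_tuples N X" "z \<in> ball_tuples N X" for I y z
    unfolding s by (intro le_sup_norm \<Phi> mix_ball that)
  then have s0: "0 \<le> s" using norm_ge_zero order_trans x by blast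
  have V: "V_form N X I a \<Phi> x = \<Phi> (mix N I x a) * \<Phi> (mix N I a x)" for I
    using a x by (intro V_form_eq ball_tuples_subset)
  have "cmod (V_sum N X a \<Phi> x) \<le> (\<Sum>I\<in>Pow {1..N}. cmod (V_form N X I a \<Phi> x))"
    unfolding V_sum_def by (rule norm_sum)
  also have "\<dots> = cmod (V_form N X J a \<Phi> x) + (\<Sum>I\<in>Pow {1..N} - {J}. cmod (V_form N X I a \<Phi> x))"
    using J by (intro sum.remove) auto
  also have "\<dots> \<le> s * cmod (\<Phi> (mix N J a x)) + (\<Sum>I\<in>Pow {1..N} - {J}. s\<^sup>2)"
    unfolding V norm_mult power2_eq_square
    by (intro add_mono mult_right_mono sum_mono mult_mono le a x s0) auto
  also have "(\<Sum>I\<in>Pow {1..N} - {J}. s\<^sup>2) = (2 ^ N - 1) * s\<^sup>2"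
    using J by (simp add: card_Diff_singleton card_Pow of_nat_diff)
  finally show ?thesis by simp
qed

text \<open>Multiplication by \<open>cnj (sgn (\<Phi> a))\<close> turns
  \<open>(\<Phi> a)\<^sup>2\<close>, the value at \<open>a\<close> of each summand, into the
  direction of \<open>\<Phi> a\<close>. If \<open>\<Phi> a = 0\<close>, the factor is 0 and nothing
  is changed.\<close>

definition perturb where
  "perturb \<epsilon> a \<Phi> = (\<lambda>x. \<Phi> x + complex_of_real \<epsilon> * cnj (sgn (\<Phi> a)) * V_sum N X a \<Phi> x)"

lemma perturb_in_U:
  assumes \<Phi>: "\<Phi> \<in> U X" and V: "V_sum N X a \<Phi> \<in> U X" and \<epsilon>: "\<epsilon> > 0"
  shows "perturb \<epsilon> a \<Phi> \<in> U X" and "dU (perturb \<epsilon> a \<Phi>) \<Phi> \<le> \<epsilon> * nU X (V_sum N X a \<Phi>)"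
proof -
  let ?c = "complex_of_real \<epsilon> * cnj (sgn (\<Phi> a))"
  have c: "?c \<in> K" using U_scalar[OF \<Phi>, of a] by auto
  show "perturb \<epsilon> a \<Phi> \<in> U X"
    unfolding perturb_def by (intro U_add U_smult c \<Phi> V)
  have "dU (perturb \<epsilon> a \<Phi>) \<Phi> = cmod ?c * nU X (V_sum N X a \<Phi>)"
    using nU_smult[OF c V] by (simp add: dU_def perturb_def)
  also have "\<dots> \<le> \<epsilon> * nU X (V_sum N X a \<Phi>)"
    using \<epsilon> nU_nonneg[OF V] by (intro mult_right_mono) (auto simp: norm_mult norm_sgn)
  finally show "dU (perturb \<epsilon> a \<Phi>) \<Phi> \<le> \<epsilon> * nU X (V_sum N X a \<Phi>)" .
qed

text \<open>The norm of the perturbed form is bounded below by its value at \<open>a\<close> and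
  above, up to \<open>\<delta>\<close>, by its value at \<open>x\<close>. Of the
  \<open>2 ^ N\<close> terms \<open>\<epsilon> * s\<^sup>2\<close> in the lower bound, the upper
  bound matches all but one; the remaining one, set against the factor for \<open>J\<close>, is the
  left-hand side.\<close>

lemma perturb_almost_attains:
  assumes \<Phi>: "\<Phi> \<in> U X" and V: "V_sum N X a \<Phi> \<in> U X" and \<epsilon>: "\<epsilon> > 0"
    and a: "a \<in> ball_tuples N X" and s: "s = sup_norm N X \<Phi>" "s > 0"
    and att: "s - \<eta> \<le> cmod (\<Phi> a)"
    and x: "x \<in> ball_tuples N X" and J: "J \<subseteq> {1..N}"
    and near: "sup_norm N X (perturb \<epsilon> a \<Phi>) - \<delta> \<le> cmod (perturb \<epsilon> a \<Phi> x)"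
  shows "\<epsilon> * s * (s - cmod (\<Phi> (mix N J a x))) \<le> \<eta> * (1 + 2 * 2 ^ N * \<epsilon> * s) + \<delta>"
proof -
  let ?r = "cmod (\<Phi> a)" and ?t = "cmod (\<Phi> (mix N J a x))"
  have "cnj (sgn z) * z\<^sup>2 = complex_of_real (cmod z) * z" for z
  proof (cases "z = 0")
    case False
    have "cnj (sgn z) * z\<^sup>2 = (z * cnj z) * z / complex_of_real (cmod z)"
      by (simp add: sgn_div_norm scaleR_conv_of_real power2_eq_square field_simps)
    also have "\<dots> = (complex_of_real (cmod z))\<^sup>2 * z / complex_of_real (cmod z)"
      by (simp flip: complex_norm_square)
    finally show ?thesis using False by (simp add: power2_eq_square)
  qed simp
  then have "perturb \<epsilon> a \<Phi> a = complex_of_real (1 + \<epsilon> * 2 ^ N * ?r) * \<Phi> a"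
    by (simp add: perturb_def V_sum_diag[OF a] algebra_simps)
  then have "cmod (perturb \<epsilon> a \<Phi> a) = (1 + \<epsilon> * 2 ^ N * ?r) * ?r"
    using \<epsilon> by (simp only: norm_mult norm_of_real) (simp add: abs_of_pos add_pos_nonneg)
  then have "(1 + \<epsilon> * 2 ^ N * ?r) * ?r \<le> sup_norm N X (perturb \<epsilon> a \<Phi>)"
    using le_sup_norm[OF perturb_in_U(1)[OF \<Phi> V \<epsilon>] a] by simp
  \<comment> \<open>The square of \<open>?r\<close> is bounded below by its tangent line at
    \<open>s\<close>, so no sign of \<open>s - \<eta>\<close> is required.\<close>
  moreover have "\<epsilon> * 2 ^ N * (s\<^sup>2 - 2 * s * \<eta>) \<le> \<epsilon> * 2 ^ N * ?r\<^sup>2"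
  proof -
    have "s\<^sup>2 - 2 * s * \<eta> \<le> 2 * s * ?r - s\<^sup>2"
      using mult_left_mono[OF att, of "2 * s"] s(2) by (simp add: algebra_simps power2_eq_square)
    also have "\<dots> \<le> ?r\<^sup>2"
      using zero_le_power2[of "?r - s"] by (simp add: power2_diff algebra_simps)
    finally show ?thesis using \<epsilon> by (intro mult_left_mono) auto
  qed
  moreover have "cmod (perturb \<epsilon> a \<Phi> x) \<le> s + \<epsilon> * ((2 ^ N - 1) * s\<^sup>2 + s * ?t)"
  proof -
    have "cmod (perturb \<epsilon> a \<Phi> x) \<le> cmod (\<Phi> x) + \<epsilon> * cmod (cnj (sgn (\<Phi> a))) * cmod (V_sum N X a \<Phi> x)"
      unfolding perturb_def using \<epsilon> by (intro norm_triangle_le) (simp add: norm_mult)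
    also have "\<dots> \<le> s + \<epsilon> * 1 * ((2 ^ N - 1) * s\<^sup>2 + s * ?t)"
      using \<epsilon> V_sum_bound[OF \<Phi> a x J s(1)] le_sup_norm[OF \<Phi> x]
      by (intro add_mono mult_mono) (auto simp: s norm_sgn)
    finally show ?thesis by simp
  qed
  ultimately show ?thesis
    using near att by (simp add: algebra_simps power2_eq_square)
qed

section \<open>The iteration and its limit form\<close>

lemma exists_attaining_near:
  assumes f: "f \<in> U X" and pos: "sup_norm N X f > 0" and e: "e > 0"
  obtains \<Psi> where "\<Psi> \<in> U X" "arens_extensions_attain K N X \<Psi>" "dU f \<Psi> < e"
proof -
  obtain M where M: "M > 0" and V: "\<And>a \<Phi>. a \<in> ball_tuples N X \<Longrightarrow> \<Phi> \<in> U X \<Longrightarrow>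
      V_sum N X a \<Phi> \<in> U X" "\<And>a \<Phi>. a \<in> ball_tuples N X \<Longrightarrow> \<Phi> \<in> U X \<Longrightarrow>
      nU X (V_sum N X a \<Phi>) \<le> M * (nU X \<Phi>)\<^sup>2"
    using V_sum_stable by metis
  define L :: real where "L = 2 ^ N"
  \<comment> \<open>All forms of the iteration will stay within ideal distance
    \<open>\<beta>\<close> of \<open>f\<close>. As \<open>\<beta> \<le> 1\<close>, their ideal norms
    are at most \<open>R\<close>; as \<open>\<beta> \<le> c\<close>, their supremum norms are at
    least \<open>2 * c - \<beta> \<ge> c\<close>. The bound \<open>e / 2\<close> makes the final
    estimate strict.\<close>
  define R where "R = nU X f + 1"
  define c where "c = sup_norm N X f / 2"
  define \<beta> where "\<beta> = min (e / 2) (min 1 c)"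
  \<comment> \<open>The three bounds serve, in turn, the total displacement
    (\<open>\<kappa>1\<close>), the halving of the errors \<open>\<delta>\<close>
    (\<open>\<kappa>2\<close>), and the estimate
    \<open>1 + 2 * 2 ^ N * \<epsilon> n * ?s \<le> 2\<close> (\<open>\<kappa>3\<close>).\<close>
  define \<kappa> where "\<kappa> = min (\<beta> / (2 * M * R\<^sup>2)) (min (1 / c) (1 / (2 * L * R)))"
  have R: "R \<ge> 1" using nU_nonneg[OF f] by (simp add: R_def)
  have L: "L > 0" by (simp add: L_def)
  have c: "c > 0" using pos by (simp add: c_def)
  have \<beta>: "\<beta> > 0" "\<beta> < e" "\<beta> \<le> 1" "\<beta> \<le> c" using e c by (auto simp: \<beta>_def)
  have \<kappa>: "\<kappa> > 0" using \<beta> M R c L by (simp add: \<kappa>_def)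
  have \<kappa>1: "\<kappa> * M * R\<^sup>2 \<le> \<beta> / 2"
  proof -
    have "\<kappa> \<le> \<beta> / (2 * M * R\<^sup>2)" by (simp add: \<kappa>_def)
    then show ?thesis using M R by (simp add: field_simps)
  qed
  have \<kappa>2: "\<kappa> * c \<le> 1"
  proof -
    have "\<kappa> \<le> 1 / c" by (simp add: \<kappa>_def)
    then show ?thesis using c by (simp add: field_simps)
  qed
  have \<kappa>3: "2 * L * \<kappa> * R \<le> 1"
  proof -
    have "\<kappa> \<le> 1 / (2 * L * R)" by (simp add: \<kappa>_def)
    then show ?thesis using L R by (simp add: field_simps)
  qed
  define \<epsilon> where "\<epsilon> k = \<kappa> / 2 ^ k" for k
  have \<epsilon>: "\<epsilon> k > 0" "\<epsilon> k \<le> \<kappa>" for k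
    using \<kappa> divide_left_mono[of 1 "2 ^ k" \<kappa>] by (simp_all add: \<epsilon>_def)
  txt \<open>With \<open>\<eta> = \<delta> (Suc k) / 2\<close>, the right-hand side of \<open>perturb_almost_attains\<close> is at most \<open>2 \<delta> (Suc k)\<close>, so this
    recursion turns an error \<open>\<delta> (Suc k)\<close> for \<open>\<Phi> (Suc k)\<close> into an error \<open>\<delta> k\<close> for \<open>\<Phi> k\<close>.\<close>
  define \<delta> where "\<delta> = rec_nat 1 (\<lambda>k d. \<epsilon> k * c * d / 2)"
  have \<delta>_Suc: "\<delta> (Suc k) = \<epsilon> k * c * \<delta> k / 2" and \<delta>_0: "\<delta> 0 = 1" for k
    by (simp_all add: \<delta>_def)
  have \<delta>_pos: "\<delta> k > 0" for k
    by (induction k) (use \<epsilon> c in \<open>simp_all add: \<delta>_Suc \<delta>_0\<close>)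
  have \<epsilon>c: "\<epsilon> k * c \<le> 1" for k
    using mult_right_mono[OF \<epsilon>(2), of c k] c \<kappa>2 by linarith
  have \<delta>_half: "\<delta> (Suc k) \<le> \<delta> k / 2" for k
    using mult_right_mono[OF \<epsilon>c, of "\<delta> k" k] \<delta>_pos[of k] by (simp add: \<delta>_Suc)
  have \<delta>_le: "\<delta> k \<le> (1 / 2) ^ k" for k
  proof (induction k)
    case (Suc k)
    then show ?case using \<delta>_half[of k] by simp
  qed (simp add: \<delta>_0)
  have \<delta>_lim: "\<delta> \<longlonglongrightarrow> 0"
    by (rule real_tendsto_sandwich[OF _ _ tendsto_const LIMSEQ_realpow_zero[of "1 / 2"]])
      (use \<delta>_le \<delta>_pos in \<open>auto intro!: always_eventually less_imp_le\<close>)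
  \<comment> \<open>Almost maximisers exist for every function, so the choice is made for all of
    them; the recursion is then defined before its members are known to lie in
    \<open>U X\<close>.\<close>
  define pick where "pick k \<Phi> = (SOME a. a \<in> ball_tuples N X \<and> sup_norm N X \<Phi> - \<delta> (Suc k) / 2 < cmod (\<Phi> a))"
    for k \<Phi>
  have "pick k \<Phi> \<in> ball_tuples N X \<and> sup_norm N X \<Phi> - \<delta> (Suc k) / 2 < cmod (\<Phi> (pick k \<Phi>))" for k \<Phi>
  proof -
    have "\<delta> (Suc k) / 2 > 0" using \<delta>_pos by simp
    then obtain a where "a \<in> ball_tuples N X" "sup_norm N X \<Phi> - \<delta> (Suc k) / 2 < cmod (\<Phi> a)"
      using sup_norm_approx[of "\<delta> (Suc k) / 2" \<Phi>] by metis
    then show ?thesis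
      unfolding pick_def
      using someI[of "\<lambda>a. a \<in> ball_tuples N X \<and> sup_norm N X \<Phi> - \<delta> (Suc k) / 2 < cmod (\<Phi> a)" a] by blast
  qed
  then have pick: "pick k \<Phi> \<in> ball_tuples N X"
    "sup_norm N X \<Phi> - \<delta> (Suc k) / 2 \<le> cmod (\<Phi> (pick k \<Phi>))" for k \<Phi>
    by (auto intro: less_imp_le)
  define \<Phi> where "\<Phi> = rec_nat f (\<lambda>k \<Phi>. perturb (\<epsilon> k) (pick k \<Phi>) \<Phi>)"
  define a where "a k = pick k (\<Phi> k)" for k
  have \<Phi>_0: "\<Phi> 0 = f" and \<Phi>_Suc: "\<Phi> (Suc k) = perturb (\<epsilon> k) (a k) (\<Phi> k)" for k
    by (simp_all add: \<Phi>_def a_def)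
  have a: "a k \<in> ball_tuples N X" "sup_norm N X (\<Phi> k) - \<delta> (Suc k) / 2 \<le> cmod (\<Phi> k (a k))" for k
    using pick by (simp_all add: a_def)
  have step: "\<Phi> (Suc k) \<in> U X \<and> dU (\<Phi> (Suc k)) (\<Phi> k) \<le> \<beta> / 2 ^ Suc k"
    if k: "\<Phi> k \<in> U X" "nU X (\<Phi> k) \<le> R" for k
  proof
    note V' = V[OF a(1)[of k] k(1)]
    show "\<Phi> (Suc k) \<in> U X"
      unfolding \<Phi>_Suc by (intro perturb_in_U k V' \<epsilon>)
    have "dU (\<Phi> (Suc k)) (\<Phi> k) \<le> \<epsilon> k * nU X (V_sum N X (a k) (\<Phi> k))"
      unfolding \<Phi>_Suc by (intro perturb_in_U k V' \<epsilon>)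
    also have "\<dots> \<le> \<epsilon> k * (M * R\<^sup>2)"
    proof -
      have "M * (nU X (\<Phi> k))\<^sup>2 \<le> M * R\<^sup>2"
        using M k nU_nonneg[OF k(1)] by (intro mult_left_mono power_mono) auto
      then show ?thesis
        using V'(2) \<epsilon>(1)[of k] by (intro mult_left_mono) auto
    qed
    also have "\<dots> = (\<kappa> * M * R\<^sup>2) / 2 ^ k"
      by (simp add: \<epsilon>_def)
    also have "\<dots> \<le> (\<beta> / 2) / 2 ^ k"
      using \<kappa>1 by (intro divide_right_mono) auto
    finally show "dU (\<Phi> (Suc k)) (\<Phi> k) \<le> \<beta> / 2 ^ Suc k" by simp
  qed
  \<comment> \<open>The bound is the partial sum of the displacements
    \<open>\<beta> / 2 ^ Suc j\<close> for \<open>j < k\<close>. Being at most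
    \<open>\<beta>\<close>, it gives the ideal norm bound \<open>R\<close> that permits the next
    step.\<close>
  have inv: "\<Phi> k \<in> U X \<and> dU (\<Phi> k) f \<le> \<beta> * (1 - 1 / 2 ^ k)" for k
  proof (induction k)
    case 0
    then show ?case using f by (simp add: \<Phi>_0 dU_def nU_zero)
  next
    case (Suc k)
    have "\<beta> * (1 - 1 / 2 ^ k) \<le> \<beta> * 1" using \<beta> by (intro mult_left_mono) auto
    then have "nU X (\<Phi> k) \<le> R"
      using nU_le_dU[of "\<Phi> k" f] dU_commute[of "\<Phi> k" f] Suc f \<beta>(3) by (simp add: R_def)
    then have st: "\<Phi> (Suc k) \<in> U X" "dU (\<Phi> (Suc k)) (\<Phi> k) \<le> \<beta> / 2 ^ Suc k"
      using step[of k] Suc by auto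
    have "dU (\<Phi> (Suc k)) f \<le> \<beta> / 2 ^ Suc k + \<beta> * (1 - 1 / 2 ^ k)"
      using dU_triangle[OF st(1) _ f, of "\<Phi> k"] st(2) Suc by linarith
    also have "\<dots> = \<beta> * (1 - 1 / 2 ^ Suc k)"
      by (simp add: field_simps)
    finally show ?case using st(1) by blast
  qed
  have \<Phi>U: "\<Phi> k \<in> U X" for k using inv by blast
  have d\<beta>: "dU (\<Phi> k) f \<le> \<beta>" for k
  proof -
    have "\<beta> * (1 - 1 / 2 ^ k) \<le> \<beta> * 1" using \<beta> by (intro mult_left_mono) auto
    then show ?thesis using inv[of k] by linarith
  qed
  have \<Phi>R: "nU X (\<Phi> k) \<le> R" for k
    using nU_le_dU[OF \<Phi>U[of k] f] dU_commute[OF \<Phi>U[of k] f] d\<beta>[of k] \<beta>(3) by (simp add: R_def)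
  have sc: "c \<le> sup_norm N X (\<Phi> k)" "sup_norm N X (\<Phi> k) \<le> R" for k
    using sup_norm_dU[OF f \<Phi>U[of k]] dU_commute[OF \<Phi>U[of k] f] d\<beta>[of k] \<beta>(4)
      sup_norm_le_nU[OF \<Phi>U[of k]] \<Phi>R[of k] by (simp_all add: c_def)
  have tele: "dU (\<Phi> (n + d)) (\<Phi> n) \<le> \<beta> * (1 / 2 ^ n - 1 / 2 ^ (n + d))" for n d
  proof (induction d)
    case 0
    then show ?case by (simp add: dU_def nU_zero)
  next
    case (Suc d)
    have "dU (\<Phi> (Suc (n + d))) (\<Phi> n) \<le> \<beta> / 2 ^ Suc (n + d) + \<beta> * (1 / 2 ^ n - 1 / 2 ^ (n + d))"
      using dU_triangle[OF \<Phi>U \<Phi>U \<Phi>U, of "Suc (n + d)" n "n + d"] step[OF \<Phi>U \<Phi>R, of "n + d"] Suc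
      by linarith
    also have "\<dots> = \<beta> * (1 / 2 ^ n - 1 / 2 ^ Suc (n + d))"
      by (simp add: field_simps)
    finally show ?case by simp
  qed
  have tail: "dU (\<Phi> m) (\<Phi> n) \<le> \<beta> / 2 ^ n" if "n \<le> m" for m n
  proof -
    have "\<beta> * (1 / 2 ^ n - 1 / 2 ^ m) \<le> \<beta> * (1 / 2 ^ n)"
      using \<beta> by (intro mult_left_mono) auto
    then show ?thesis using tele[of n "m - n"] that by simp
  qed
  \<comment> \<open>Completeness of the ideal norm enters here: the geometric tails make the
    sequence Cauchy.\<close>
  obtain \<Psi> where \<Psi>: "\<Psi> \<in> U X" and lim: "(\<lambda>n. dU (\<Phi> n) \<Psi>) \<longlonglongrightarrow> 0"
  proof (rule U_complete[of \<Phi>])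
    fix r :: real assume r: "r > 0"
    have "(\<lambda>n. \<beta> * (1 / 2) ^ n) \<longlonglongrightarrow> \<beta> * 0"
      by (intro tendsto_mult tendsto_const LIMSEQ_realpow_zero) auto
    then have "eventually (\<lambda>n. \<beta> * (1 / 2) ^ n < r) sequentially"
      using r by (intro order_tendstoD) auto
    then obtain M where M: "\<beta> / 2 ^ n < r" if "n \<ge> M" for n
      by (auto simp: eventually_sequentially power_divide)
    have "dU (\<Phi> m) (\<Phi> n) < r" if "m \<ge> M" "n \<ge> M" for m n
      using tail[of n m] tail[of m n] M that dU_commute[OF \<Phi>U \<Phi>U, of m n]
      by (cases "n \<le> m") (auto intro: le_less_trans)
    then show "\<exists>M. \<forall>m\<ge>M. \<forall>n\<ge>M. nU X (\<lambda>x. \<Phi> m x - \<Phi> n x) < r"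
      unfolding dU_def by blast
  qed (use \<Phi>U that in \<open>auto simp: dU_def\<close>)
  have "dU f \<Psi> \<le> \<beta>"
  proof -
    have "(\<lambda>n. \<beta> + dU (\<Phi> n) \<Psi>) \<longlonglongrightarrow> \<beta> + 0"
      by (intro tendsto_add tendsto_const lim)
    moreover have "dU f \<Psi> \<le> \<beta> + dU (\<Phi> n) \<Psi>" for n
      using dU_triangle[OF f \<Phi>U \<Psi>, of n] d\<beta>[of n] dU_commute[OF \<Phi>U[of n] f] by linarith
    ultimately show ?thesis using LIMSEQ_le_const by fastforce
  qed
  then have near: "dU f \<Psi> < e" using \<beta>(2) by linarith
  have tuple_ball: "(\<lambda>i\<in>{1..N}. a (\<nu> i) i) \<in> ball_tuples N X" for \<nu>
    using ball_tuples_mem[OF a(1)] by (auto simp: ball_tuples_def)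
  \<comment> \<open>Downward induction on \<open>n\<close> from an upper bound \<open>m\<close> of
    the indices; the error \<open>\<delta> n\<close> is independent of \<open>m\<close>. In the base
    case all indices equal \<open>m\<close>, so the tuple is \<open>a m\<close> itself.\<close>
  have almost: "sup_norm N X (\<Phi> n) - \<delta> n \<le> cmod (\<Phi> n (\<lambda>i\<in>{1..N}. a (\<nu> i) i))"
    if "n \<le> m" "\<And>i. i \<in> {1..N} \<Longrightarrow> n \<le> \<nu> i \<and> \<nu> i \<le> m" for n m \<nu>
    using that
  proof (induction n arbitrary: \<nu> rule: inc_induct)
    case base
    have "(\<lambda>i\<in>{1..N}. a (\<nu> i) i) = a m"
    proof
      fix i
      show "(\<lambda>i\<in>{1..N}. a (\<nu> i) i) i = a m i"
        using base[of i] a(1)[of m]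
        by (cases "i \<in> {1..N}") (auto simp: ball_tuples_def PiE_def extensional_def)
    qed
    moreover have "\<delta> (Suc m) / 2 \<le> \<delta> m"
      using \<delta>_half[of m] \<delta>_pos[of m] by simp
    ultimately show ?case using a(2)[of m] by simp
  next
    case (step n)
    \<comment> \<open>Indices equal to \<open>n\<close> are raised to \<open>Suc n\<close>, so that
      the induction hypothesis applies to \<open>y\<close>; mixing \<open>a n\<close> back in on
      \<open>J\<close> restores the given tuple. If \<open>J\<close> is empty, the step still passes
      from \<open>\<Phi> (Suc n)\<close> to \<open>\<Phi> n\<close>.\<close>
    define \<nu>' where "\<nu>' i = max (Suc n) (\<nu> i)" for i
    define y where "y = (\<lambda>i\<in>{1..N}. a (\<nu>' i) i)"
    define J where "J = {i \<in> {1..N}. \<nu> i = n}"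
    let ?s = "sup_norm N X (\<Phi> n)" and ?x = "\<lambda>i\<in>{1..N}. a (\<nu> i) i"
    have IH: "sup_norm N X (\<Phi> (Suc n)) - \<delta> (Suc n) \<le> cmod (\<Phi> (Suc n) y)"
      unfolding y_def using step.prems step.hyps by (intro step.IH) (auto simp: \<nu>'_def)
    have "mix N J (a n) y i = ?x i" for i
      using step.prems[of i] by (auto simp: mix_def J_def y_def \<nu>'_def max_def)
    then have mix: "mix N J (a n) y = ?x" by (rule ext)
    have spos: "?s > 0" using sc(1)[of n] c by linarith
    have "\<epsilon> n * ?s * (?s - cmod (\<Phi> n (mix N J (a n) y)))
        \<le> \<delta> (Suc n) / 2 * (1 + 2 * 2 ^ N * \<epsilon> n * ?s) + \<delta> (Suc n)"
      by (rule perturb_almost_attains[OF \<Phi>U V(1)[OF a(1) \<Phi>U] \<epsilon>(1) a(1) refl spos a(2)])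
        (use IH tuple_ball in \<open>auto simp: \<Phi>_Suc y_def J_def\<close>)
    also have "\<dots> \<le> \<delta> (Suc n) / 2 * 2 + \<delta> (Suc n)"
    proof -
      have "2 * L * \<epsilon> n * ?s \<le> 2 * L * \<kappa> * R"
        using \<epsilon>[of n] \<kappa> L sc(2)[of n] spos by (intro mult_mono) auto
      then have "1 + 2 * 2 ^ N * \<epsilon> n * ?s \<le> 2" using \<kappa>3 unfolding L_def by linarith
      then show ?thesis using \<delta>_pos[of "Suc n"] by (intro add_mono mult_left_mono) auto
    qed
    also have "\<dots> = \<epsilon> n * c * \<delta> n" by (simp add: \<delta>_Suc)
    \<comment> \<open>Replacing \<open>c\<close> by the larger supremum norm makes
      \<open>\<epsilon> n * ?s\<close> a common positive factor of both sides, which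
      cancels.\<close>
    also have "\<dots> \<le> \<epsilon> n * ?s * \<delta> n"
      using \<epsilon>(1)[of n] \<delta>_pos[of n] sc(1)[of n] by (intro mult_right_mono mult_left_mono) auto
    finally have "?s - cmod (\<Phi> n ?x) \<le> \<delta> n"
      using \<epsilon>(1)[of n] spos by (simp add: mix)
    then show ?case by linarith
  qed
  \<comment> \<open>The distance to the limit counts twice: once for the supremum norm and once for
    the value at the tuple.\<close>
  define \<rho> where "\<rho> n = \<delta> n + 2 * dU (\<Phi> n) \<Psi>" for n
  have \<rho>: "\<rho> \<longlonglongrightarrow> 0"
    using tendsto_add[OF \<delta>_lim tendsto_mult[OF tendsto_const lim, of 2]] by (simp add: \<rho>_def[abs_def])
  interpret bounded_form K N X \<Psi> "nU X \<Psi>"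
    using \<Psi> by (rule U_bounded_form)
  have "arens_extensions_attain K N X \<Psi>"
  proof (rule arens_extensions_attainI[OF a(1) \<rho>])
    show "cmod (\<Psi> x) \<le> sup_norm N X \<Psi>" if "x \<in> ball_tuples N X" for x
      using \<Psi> that by (rule le_sup_norm)
    fix n and \<nu> :: "nat \<Rightarrow> nat" assume \<nu>: "\<And>i. i \<in> {1..N} \<Longrightarrow> n \<le> \<nu> i"
    let ?x = "\<lambda>i\<in>{1..N}. a (\<nu> i) i"
    \<comment> \<open>Only finitely many indices occur, so they have a common upper bound;
      \<open>n\<close> is inserted to ensure \<open>n \<le> m\<close>.\<close>
    define m where "m = Max (insert n (\<nu> ` {1..N}))"
    have m: "\<nu> i \<le> m" if "i \<in> {1..N}" for i
      unfolding m_def using that by (intro Max_ge) auto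
    have "n \<le> m" unfolding m_def by (intro Max_ge) auto
    then have "sup_norm N X (\<Phi> n) - \<delta> n \<le> cmod (\<Phi> n ?x)"
      by (rule almost) (use \<nu> m in blast)
    moreover have "cmod (\<Phi> n ?x) \<le> cmod (\<Psi> ?x) + dU (\<Phi> n) \<Psi>"
      by (intro value_dU \<Phi>U \<Psi> tuple_ball)
    moreover have "sup_norm N X \<Psi> \<le> sup_norm N X (\<Phi> n) + dU (\<Phi> n) \<Psi>"
      using sup_norm_dU[OF \<Psi> \<Phi>U, of n] dU_commute[OF \<Phi>U \<Psi>, of n] by simp
    ultimately show "sup_norm N X \<Psi> - \<rho> n \<le> cmod (\<Psi> ?x)"
      unfolding \<rho>_def by linarith
  qed
  then show thesis using that \<Psi> near by blast
qed

text \<open>The iteration needs a positive supremum norm. Here the lower bound required at every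
  tuple is at most 0, so the constant sequence of zero tuples with zero error suffices.\<close>

lemma attain_if_sup_norm_zero:
  assumes "\<Phi> \<in> U X" "sup_norm N X \<Phi> \<le> 0"
  shows "arens_extensions_attain K N X \<Phi>"
proof -
  interpret bounded_form K N X \<Phi> "nU X \<Phi>"
    using assms(1) by (rule U_bounded_form)
  show ?thesis
  proof (rule arens_extensions_attainI[OF zero_tuple_in_ball tendsto_const[of 0]])
    show "cmod (\<Phi> x) \<le> sup_norm N X \<Phi>" if "x \<in> ball_tuples N X" for x
      using assms(1) that by (rule le_sup_norm)
    show "sup_norm N X \<Phi> - 0 \<le> cmod (\<Phi> y)" for y
      using assms(2) norm_ge_zero[of "\<Phi> y"] by linarith
  qed
qed

end

section \<open>Density in the ideal norm\<close>

theorem theorem1p2: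
  fixes K :: "complex set" and N :: nat
    and U :: "(nat \<Rightarrow> (complex + 'a) normed_module) \<Rightarrow> ((nat \<Rightarrow> complex + 'a) \<Rightarrow> complex) set"
    and nU :: "(nat \<Rightarrow> (complex + 'a) normed_module) \<Rightarrow> ((nat \<Rightarrow> complex + 'a) \<Rightarrow> complex) \<Rightarrow> real"
    and X :: "nat \<Rightarrow> (complex + 'a) normed_module"
  assumes "K = \<real> \<or> K = UNIV"
    and "1 \<le> N"
    and "banach_ideal K N U nU"
    and "\<forall>i\<in>{1..N}. banach_space K (X i)"
    and "stable_at N U nU X"
  shows "norm_topology (ideal_space U nU X) closure_of {\<Phi> \<in> U X. arens_extensions_attain K N X \<Phi>}
           = U X"
proof -
  interpret stable_ideal_at K N U nU X
    using assms by unfold_locales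
  show ?thesis
  proof (rule closure_eq_UI)
    fix \<Phi> and e :: real assume \<Phi>: "\<Phi> \<in> U X" and e: "e > 0"
    show "\<exists>\<Psi>\<in>{\<Phi> \<in> U X. arens_extensions_attain K N X \<Phi>}. nU X (\<lambda>x. \<Phi> x - \<Psi> x) < e"
    proof (cases "sup_norm N X \<Phi> > 0")
      case True
      then show ?thesis
        by (rule exists_attaining_near[OF \<Phi> _ e]) (auto simp: dU_def)
    next
      case False
      then show ?thesis
        using \<Phi> e attain_if_sup_norm_zero[OF \<Phi>] by (intro bexI[of _ \<Phi>]) (auto simp: nU_zero)
    qed
  qed auto
qed

end
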